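(* There exists $\beta>0$ such that, for all sufficiently large $n$, there are at least $n!\,(1-\exp(-n^{\beta}))$ permutations $\sigma\in\mathcal{S}_n$ for which $|[\mathrm{id},\sigma]|$ (the size of the interval from $\mathrm{id}$ to $\sigma$ in the weak Bruhat order) can be computed in time $e^{(2+o(1))\sqrt{n}\log n}$, where $o(1)$ denotes a quantity tending to $0$ as $n\to\infty$.
   Context: $\mathcal{S}_n$ is the set of permutations (bijections) of $[n]=\{1,\dots,n\}$ and $\mathrm{id}$ is the identity permutation; composition is $(fg)(x)=f(g(x))$. Weak Bruhat order $\prec$ on $\mathcal{S}_n$: the reflexive and transitive closure of the covering relation $\lessdot$, where $\sigma_1\lessdot\sigma_2$ if and only if there is an adjacent transposition $\tau$ exchanging $k$ and $l$ (so $|k-l|=1$) with $\sigma_1=\sigma_2\tau$, $k<l$ and $\sigma_1(k)<\sigma_1(l)$. The interval $[\mathrm{id},\sigma]$ is $\{\rho\in\mathcal{S}_n:\mathrm{id}\prec\rho\prec\sigma\}$. Running times are in the usual sense of algorithm analysis: an algorithm takes the permutation $\sigma$ as input and outputs the integer $|[\mathrm{id},\sigma]|$, within the stated time on the permutations in question; no particular machine model is specified. *)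

theory Defs
  imports
    "HOL-Combinatorics.Permutations"
    "HOL-Library.Log_Nat"
    Complex_Main
begin

definition weak_cover :: "nat \<Rightarrow> (nat \<Rightarrow> nat) \<Rightarrow> (nat \<Rightarrow> nat) \<Rightarrow> bool" where
  "weak_cover n \<sigma>\<^sub>1 \<sigma>\<^sub>2 \<longleftrightarrow>
     \<sigma>\<^sub>1 permutes {1..n} \<and> \<sigma>\<^sub>2 permutes {1..n} \<and>
     (\<exists>k l. k \<in> {1..n} \<and> l \<in> {1..n} \<and> l = k + 1 \<and>
            \<sigma>\<^sub>1 = \<sigma>\<^sub>2 \<circ> transpose k l \<and> \<sigma>\<^sub>1 k < \<sigma>\<^sub>1 l)"

definition weak_le :: "nat \<Rightarrow> (nat \<Rightarrow> nat) \<Rightarrow> (nat \<Rightarrow> nat) \<Rightarrow> bool" where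
  "weak_le n = (weak_cover n)\<^sup>*\<^sup>*"

definition weak_interval :: "nat \<Rightarrow> (nat \<Rightarrow> nat) \<Rightarrow> (nat \<Rightarrow> nat) set" where
  "weak_interval n \<sigma> = {\<rho>. \<rho> permutes {1..n} \<and> weak_le n id \<rho> \<and> weak_le n \<rho> \<sigma>}"

text \<open>
  The machine of Cook and Reckhow (Time bounded random access machines, 1973): registers
  \<open>X\<^sub>0, X\<^sub>1, \<dots>\<close>, all initially \<open>0\<close>, a read-only input sequence, and a fixed finite program.
  Registers hold natural numbers (subtraction is truncated) instead of integers, and the
  output is the content of \<open>X\<^sub>0\<close> on termination.
  The machine stops when the program counter points outside the program.
\<close>

datatype instr =
    Const nat nat
  | Add nat nat nat
  | Sub nat nat nat
  | Load nat nat
  | Store nat nat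
  | Jump_pos nat nat
  | Read nat

text \<open>Program counter, registers, unread input.\<close>

type_synonym config = "nat \<times> (nat \<Rightarrow> nat) \<times> nat list"

fun step :: "instr \<Rightarrow> config \<Rightarrow> config" where
  "step (Const i c) (pc, X, inp) = (pc + 1, X(i := c), inp)"
| "step (Add i j k) (pc, X, inp) = (pc + 1, X(i := X j + X k), inp)"
| "step (Sub i j k) (pc, X, inp) = (pc + 1, X(i := X j - X k), inp)"
| "step (Load i j) (pc, X, inp) = (pc + 1, X(i := X (X j)), inp)"
| "step (Store i j) (pc, X, inp) = (pc + 1, X(X i := X j), inp)"
| "step (Jump_pos j l) (pc, X, inp) = (if X j > 0 then l else pc + 1, X, inp)"
| "step (Read i) (pc, X, []) = (pc + 1, X(i := 0), [])"
| "step (Read i) (pc, X, a # inp) = (pc + 1, X(i := a), inp)"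

text \<open>
  \<open>floorlog 2 a\<close> is the number of binary digits of \<open>a > 0\<close>. An instruction costs the total
  length of the numbers it operates on, including addresses computed at run time; so
  arithmetic on long numbers is not free.
\<close>

definition len :: "nat \<Rightarrow> nat" where
  "len a = max 1 (floorlog 2 a)"

fun cost :: "instr \<Rightarrow> config \<Rightarrow> nat" where
  "cost (Const i c) (pc, X, inp) = len c"
| "cost (Add i j k) (pc, X, inp) = len (X j) + len (X k)"
| "cost (Sub i j k) (pc, X, inp) = len (X j) + len (X k)"
| "cost (Load i j) (pc, X, inp) = len (X j) + len (X (X j))"
| "cost (Store i j) (pc, X, inp) = len (X i) + len (X j)"
| "cost (Jump_pos j l) (pc, X, inp) = len (X j)"
| "cost (Read i) (pc, X, []) = 1"
| "cost (Read i) (pc, X, a # inp) = len a"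

text \<open>\<open>run P c t c'\<close>: started in \<open>c\<close>, program \<open>P\<close> stops in \<open>c'\<close> after total cost \<open>t\<close>.\<close>

inductive run :: "instr list \<Rightarrow> config \<Rightarrow> nat \<Rightarrow> config \<Rightarrow> bool" for P where
  stop: "length P \<le> fst c \<Longrightarrow> run P c 0 c"
| step: "fst c < length P \<Longrightarrow> run P (step (P ! fst c) c) t c' \<Longrightarrow>
           run P c (cost (P ! fst c) c + t) c'"

definition ram_computes :: "instr list \<Rightarrow> nat list \<Rightarrow> nat \<Rightarrow> nat \<Rightarrow> bool" where
  "ram_computes P inp out t \<longleftrightarrow>
     (\<exists>pc X rest. run P (0, \<lambda>_. 0, inp) t (pc, X, rest) \<and> X 0 = out)"

definition perm_input :: "nat \<Rightarrow> (nat \<Rightarrow> nat) \<Rightarrow> nat list" where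
  "perm_input n \<sigma> = n # map \<sigma> [1..<n+1]"

end

theory Submission
  imports Defs "HOL-Combinatorics.Multiset_Permutations" "HOL-Real_Asymp.Real_Asymp"
begin

text \<open>
  The interval \<open>[id, \<sigma>]\<close> consists of the linear extensions of the poset on \<open>{1..n}\<close> in which
  \<open>a\<close> lies below \<open>b\<close> iff \<open>a < b\<close> and \<open>a\<close> precedes \<open>b\<close> in \<open>\<sigma>\<close>. Greedily peeling off chains (left-to-right
  maxima of what is left) yields as many chains as a longest decreasing subsequence has elements.
  A set that is an end segment of each chain is coded by a mixed radix number below
  \<open>M = \<Prod> (s\<^sub>c + 1)\<close>, where \<open>s\<^sub>c\<close> are the chain lengths; its number \<open>e(I)\<close> of linear extensions
  satisfies \<open>e(I) = \<Sum> e(I - {x})\<close> over the minimal \<open>x\<close>, and these sets are closed under removing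
  minimal elements. So a table of size \<open>M\<close> suffices, at polynomial cost per entry.

  A fixed set of \<open>k\<close> positions carries a decreasing subsequence with probability \<open>1/k!\<close>, so by the
  union bound all but a fraction \<open>exp(-c sqrt n)\<close> of the permutations have fewer than
  \<open>(7/2) sqrt n\<close> chains. For these concavity of \<open>ln\<close> gives \<open>ln M \<le> (7/4) sqrt n ln n + O(sqrt n)\<close>,
  which leaves room for the polynomial factors below \<open>2 sqrt n ln n\<close>; hence \<open>\<epsilon> = 0\<close> works. Any
  constant between \<open>e\<close> and \<open>4\<close> could replace \<open>7/2\<close>.
\<close>

section \<open>A loop language compiled to the machine\<close>

text \<open>Time must be charged on a concrete machine with logarithmic cost, so correctness,
  instruction count and size of numbers have to be bounded together. The ghost counters of the loop
  language do this: time is at most the instruction count times twice the length of the largest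
  number. That number is at most \<open>16 * 2 ^ n + fact n + 40\<close> for every permutation, so
  lengths stay polynomial and the number of chains enters only through M. Hence a single program
  serves all permutations, and the exceptional ones merely run longer.

  Greedy peeling suffices because an element left over by a scan has a larger element to its left on
  the chain just built; following such witnesses back through the earlier chains gives a decreasing
  subsequence with one element per chain.

  The weight of a new chain is one more than the sum of all weights assigned before. So the machine,
  which cannot multiply, finds the weights by addition and decodes by comparing and subtracting.

  For k = c sqrt n the failure probability is at most (n choose k) / k!, hence at most (e sqrt n /
  k)^(2k), which asks for c > e; and ln M is about (c/2) sqrt n ln n, which asks for c < 4.\<close>

datatype com =
    VConst nat nat
  | VAdd nat nat nat
  | VSub nat nat nat
  | Fetch nat nat nat
  | Put nat nat nat
  | Input nat
  | Seq com com  (infixr ";;" 60)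
  | IfPos nat com
  | Loop nat com

text \<open>
  The last two components are ghost state: \<open>clock\<close> bounds the number of machine instructions
  executed so far, and \<open>peak\<close> bounds every number that has occurred so far.
\<close>

record state =
  var :: "nat \<Rightarrow> nat"
  arr :: "nat \<Rightarrow> nat \<Rightarrow> nat"
  inp :: "nat list"
  clock :: nat
  peak :: nat

abbreviation tick :: "nat \<Rightarrow> nat \<Rightarrow> state \<Rightarrow> state" where
  "tick t b s \<equiv> s\<lparr>clock := clock s + t, peak := max (peak s) b\<rparr>"

abbreviation setv :: "nat \<Rightarrow> nat \<Rightarrow> state \<Rightarrow> state" where
  "setv x a s \<equiv> s\<lparr>var := (var s)(x := a)\<rparr>"

text \<open>The counter is decremented before the body runs, so the body sees the values m - 1, ...,
  0. The tick covers the five control instructions of a round, with one to spare, and the constant 1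
  that they load.\<close>

definition iter :: "nat \<Rightarrow> nat \<Rightarrow> state \<Rightarrow> state" where
  "iter x k s = tick 6 1 (setv x k s)"

text \<open>
  Entry \<open>i\<close> of array \<open>a\<close> is stored at address \<open>8 * i + 16 + a\<close>; the registers 14 and 15 are
  scratch space.
\<close>

primrec exec :: "com \<Rightarrow> state \<Rightarrow> state" where
  "exec (VConst x c) s = tick 1 c (setv x c s)"
| "exec (VAdd x y z) s = tick 1 (var s y + var s z) (setv x (var s y + var s z) s)"
| "exec (VSub x y z) s = tick 1 0 (setv x (var s y - var s z) s)"
| "exec (Fetch x a i) s = tick 6 (8 * var s i + 16 + a) (setv x (arr s a (var s i)) s)"
| "exec (Put a i x) s =
     tick 6 (8 * var s i + 16 + a) (s\<lparr>arr := (arr s)(a := (arr s a)(var s i := var s x))\<rparr>)"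
| "exec (Input x) s =
     (case inp s of [] \<Rightarrow> tick 1 0 (setv x 0 s) | b # bs \<Rightarrow> tick 1 b (setv x b s\<lparr>inp := bs\<rparr>))"
| "exec (c ;; d) s = exec d (exec c s)"
| "exec (IfPos x c) s = (if var s x > 0 then exec c (tick 3 1 s) else tick 3 1 s)"
| "exec (Loop x c) s = tick 3 1 (fold (\<lambda>k s. exec c (iter x k s)) (rev [0..<var s x]) s)"

lemmas exec_Loop = exec.simps(9)
declare exec_Loop [simp del]

primrec writes :: "com \<Rightarrow> nat set" where
  "writes (VConst x c) = {x}"
| "writes (VAdd x y z) = {x}"
| "writes (VSub x y z) = {x}"
| "writes (Fetch x a i) = {x}"
| "writes (Put a i x) = {}"
| "writes (Input x) = {x}"
| "writes (c ;; d) = writes c \<union> writes d"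
| "writes (IfPos x c) = writes c"
| "writes (Loop x c) = insert x (writes c)"

text \<open>The bounds keep variables off the scratch registers and arrays apart in memory. A body
  must not write its loop counter, because \<open>exec\<close> fixes the number of rounds in advance
  while the machine tests the counter in every round.\<close>

primrec wf_com :: "com \<Rightarrow> bool" where
  "wf_com (VConst x c) \<longleftrightarrow> x < 14"
| "wf_com (VAdd x y z) \<longleftrightarrow> x < 14 \<and> y < 14 \<and> z < 14"
| "wf_com (VSub x y z) \<longleftrightarrow> x < 14 \<and> y < 14 \<and> z < 14"
| "wf_com (Fetch x a i) \<longleftrightarrow> x < 14 \<and> a < 8 \<and> i < 14"
| "wf_com (Put a i x) \<longleftrightarrow> x < 14 \<and> a < 8 \<and> i < 14"
| "wf_com (Input x) \<longleftrightarrow> x < 14"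
| "wf_com (c ;; d) \<longleftrightarrow> wf_com c \<and> wf_com d"
| "wf_com (IfPos x c) \<longleftrightarrow> x < 14 \<and> wf_com c"
| "wf_com (Loop x c) \<longleftrightarrow> x < 14 \<and> x \<notin> writes c \<and> wf_com c"

primrec csize :: "com \<Rightarrow> nat" where
  "csize (VConst x c) = 1"
| "csize (VAdd x y z) = 1"
| "csize (VSub x y z) = 1"
| "csize (Fetch x a i) = 6"
| "csize (Put a i x) = 6"
| "csize (Input x) = 1"
| "csize (c ;; d) = csize c + csize d"
| "csize (IfPos x c) = csize c + 3"
| "csize (Loop x c) = csize c + 7"

definition locate :: "nat \<Rightarrow> nat \<Rightarrow> instr list" where
  "locate a i = [Add 14 i i, Add 14 14 14, Add 14 14 14, Const 15 (16 + a), Add 14 14 15]"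

text \<open>Jump targets are absolute, so the address \<open>p\<close> is a parameter and
  \<open>csize\<close> must be known beforehand. Loading 1 into register 14 makes
  \<open>Jump_pos\<close> unconditional.\<close>

primrec compile :: "nat \<Rightarrow> com \<Rightarrow> instr list" where
  "compile p (VConst x c) = [Const x c]"
| "compile p (VAdd x y z) = [Add x y z]"
| "compile p (VSub x y z) = [Sub x y z]"
| "compile p (Fetch x a i) = locate a i @ [Load x 14]"
| "compile p (Put a i x) = locate a i @ [Store 14 x]"
| "compile p (Input x) = [Read x]"
| "compile p (c ;; d) = compile p c @ compile (p + csize c) d"
| "compile p (IfPos x c) =
     [Jump_pos x (p + 3), Const 14 1, Jump_pos 14 (p + csize c + 3)] @ compile (p + 3) c"
| "compile p (Loop x c) =
     [Jump_pos x (p + 3), Const 14 1, Jump_pos 14 (p + csize c + 7), Const 14 1, Sub x x 14]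
     @ compile (p + 5) c @ [Const 14 1, Jump_pos 14 p]"

lemma length_compile [simp]: "length (compile p c) = csize c"
  by (induction c arbitrary: p) (auto simp: locate_def)

lemma fold_invariant_state:
  assumes "P s" and "\<And>k s. P s \<Longrightarrow> P (f k s)"
  shows "P (fold f ks s)"
  using assms by (induction ks arbitrary: s) auto

text \<open>Carries a bound on the final peak back to all intermediate states.\<close>

lemma peak_exec: "peak s \<le> peak (exec c s)"
proof (induction c arbitrary: s)
  case (Seq c d)
  then show ?case by (simp add: le_trans[OF Seq(1) Seq(2)])
next
  case (IfPos x c)
  show ?case using IfPos[of "tick 3 1 s"] by simp
next
  case (Loop x c)
  have "peak s \<le> peak (fold (\<lambda>k s. exec c (iter x k s)) ks s)" for ks
    by (rule fold_invariant_state[where P = "\<lambda>s'. peak s \<le> peak s'"])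
       (use Loop in \<open>auto intro!: le_trans[OF _ Loop] simp: iter_def\<close>)
  from this[of "rev [0..<var s x]"] show ?case unfolding exec_Loop by simp
qed (auto split: list.split)

lemma exec_unchanged: "y \<notin> writes c \<Longrightarrow> var (exec c s) y = var s y"
proof (induction c arbitrary: s)
  case (Loop x c)
  have "var (fold (\<lambda>k s. exec c (iter x k s)) ks s) y = var s y" for ks
    by (rule fold_invariant_state[where P = "\<lambda>s'. var s' y = var s y"])
       (use Loop in \<open>auto simp: iter_def\<close>)
  from this[of "rev [0..<var s x]"] show ?case unfolding exec_Loop by simp
qed (auto split: list.split)

lemma exec_Loop_0: "var s x = 0 \<Longrightarrow> exec (Loop x c) s = tick 3 1 s"
  by (simp add: exec_Loop)

text \<open>Mirrors the jump back to the loop head: since the body cannot write the counter, the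
  restarted loop finds \<open>k\<close> in it.\<close>

lemma exec_Loop_Suc:
  assumes "x \<notin> writes c" and "var s x = Suc k"
  shows "exec (Loop x c) s = exec (Loop x c) (exec c (iter x k s))"
proof -
  have "var (exec c (iter x k s)) x = k"
    by (simp add: exec_unchanged[OF assms(1)] iter_def)
  then show ?thesis using assms(2) by (simp add: exec_Loop)
qed

text \<open>The index of \<open>P\<close> counts the rounds still to come.\<close>

lemma Loop_invariant:
  assumes "P (var s x) s"
    and "\<And>k s'. k < var s x \<Longrightarrow> P (Suc k) s' \<Longrightarrow> P k (exec c (iter x k s'))"
    and "\<And>s'. P 0 s' \<Longrightarrow> Q (tick 3 1 s')"
  shows "Q (exec (Loop x c) s)"
proof -
  have "P 0 (fold (\<lambda>k s. exec c (iter x k s)) (rev [0..<m]) s')"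
    if "m \<le> var s x" "P m s'" for m s'
    using that
  proof (induction m arbitrary: s')
    case (Suc m)
    then show ?case using assms(2)[of m s'] by simp
  qed simp
  with assms(1,3) show ?thesis by (simp add: exec_Loop)
qed

subsection \<open>Correctness of the compiler\<close>

text \<open>Unlike \<open>run\<close>, this may end at any program counter, so that executions of
  code fragments can be concatenated.\<close>

inductive steps :: "instr list \<Rightarrow> config \<Rightarrow> nat \<Rightarrow> config \<Rightarrow> bool" for P where
  stay: "steps P c 0 c"
| move: "fst c < length P \<Longrightarrow> steps P (step (P ! fst c) c) t c' \<Longrightarrow>
           steps P c (cost (P ! fst c) c + t) c'"

lemma steps_trans: "steps P c t c' \<Longrightarrow> steps P c' t' c'' \<Longrightarrow> steps P c (t + t') c''"
  by (induction rule: steps.induct) (auto simp: add.assoc intro: steps.move)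

lemma steps_run: "steps P c t c' \<Longrightarrow> length P \<le> fst c' \<Longrightarrow> run P c t c'"
  by (induction rule: steps.induct) (auto intro: run.intros)

definition fetches :: "instr list \<Rightarrow> nat \<Rightarrow> instr list \<Rightarrow> bool" where
  "fetches P p C \<longleftrightarrow> (\<exists>pre post. P = pre @ C @ post \<and> length pre = p)"

lemma fetches_Nil [simp]: "fetches P p [] \<longleftrightarrow> p \<le> length P"
proof
  assume "p \<le> length P"
  then have "P = take p P @ [] @ drop p P" "length (take p P) = p" by simp_all
  then show "fetches P p []" unfolding fetches_def by blast
qed (auto simp: fetches_def)

lemma fetches_Cons: "fetches P p (i # C) \<longleftrightarrow> p < length P \<and> P ! p = i \<and> fetches P (Suc p) C"
proof
  assume "fetches P p (i # C)"
  then obtain pre post where "P = pre @ (i # C) @ post" "length pre = p"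
    by (auto simp: fetches_def)
  moreover from this have "P = (pre @ [i]) @ C @ post" "length (pre @ [i]) = Suc p" by simp_all
  ultimately show "p < length P \<and> P ! p = i \<and> fetches P (Suc p) C"
    unfolding fetches_def by (auto simp: nth_append simp del: append_assoc)
next
  assume *: "p < length P \<and> P ! p = i \<and> fetches P (Suc p) C"
  then obtain pre post where pre: "P = pre @ C @ post" "length pre = Suc p"
    by (auto simp: fetches_def)
  then obtain pre' j where "pre = pre' @ [j]" by (metis append_butlast_last_id length_0_conv nat.distinct(1))
  with * pre have "P = pre' @ (i # C) @ post" "length pre' = p"
    by (auto simp: nth_append)
  then show "fetches P p (i # C)" unfolding fetches_def by blast
qed

lemma fetches_append:
  "fetches P p (C @ D) \<longleftrightarrow> fetches P p C \<and> fetches P (p + length C) D"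
proof (induction C arbitrary: p)
  case Nil
  then show ?case by (auto simp: fetches_def)
next
  case (Cons a C)
  then show ?case by (simp add: fetches_Cons)
qed

text \<open>The scratch registers are constrained only by the last clause, which is what turns
  \<open>peak\<close> into a bound on the cost of an instruction.\<close>

definition represents :: "state \<Rightarrow> (nat \<Rightarrow> nat) \<Rightarrow> bool" where
  "represents s X \<longleftrightarrow> (\<forall>x<14. X x = var s x) \<and> (\<forall>a<8. \<forall>i. X (8 * i + 16 + a) = arr s a i) \<and>
     (\<forall>i. X i \<le> peak s)"


lemma len_mono: "a \<le> b \<Longrightarrow> len a \<le> len b"
  unfolding len_def using floorlog_mono[of a b 2] by auto

text \<open>Every instruction is charged for at most two numbers. The last two premises cover the
  numbers that do not come from registers.\<close>

lemma cost_le: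
  assumes "\<And>i. X i \<le> B" "\<And>i a. ins = Const i a \<Longrightarrow> a \<le> B"
    "\<And>i a l'. ins = Read i \<Longrightarrow> l = a # l' \<Longrightarrow> a \<le> B"
  shows "cost ins (p, X, l) \<le> 2 * len B"
proof -
  have *: "a \<le> B \<Longrightarrow> b \<le> B \<Longrightarrow> len a + len b \<le> 2 * len B" for a b
    using len_mono[of a B] len_mono[of b B] by linarith
  have **: "a \<le> B \<Longrightarrow> len a \<le> 2 * len B" for a
    using len_mono[of a B] by linarith
  have "1 \<le> 2 * len B" by (simp add: len_def)
  with assms * ** show ?thesis by (cases ins; cases l) simp_all
qed

text \<open>Exact costs are forgotten: \<open>n\<close> instructions at cost at most
  \<open>K\<close> each on average. Such bounds add up under concatenation.\<close>

definition reach :: "instr list \<Rightarrow> nat \<Rightarrow> config \<Rightarrow> nat \<Rightarrow> config \<Rightarrow> bool" where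
  "reach P K c n c' \<longleftrightarrow> (\<exists>t\<le>K * n. steps P c t c')"

lemma reach_trans: "reach P K c n c' \<Longrightarrow> reach P K c' m c'' \<Longrightarrow> reach P K c (n + m) c''"
  unfolding reach_def by (metis add_mono distrib_left steps_trans)

lemma reach_one:
  assumes "p < length P" "P ! p = ins" "\<And>i. X i \<le> B" "\<And>i a. ins = Const i a \<Longrightarrow> a \<le> B"
    "\<And>i a l'. ins = Read i \<Longrightarrow> l = a # l' \<Longrightarrow> a \<le> B"
    "step ins (p, X, l) = c'"
  shows "reach P (2 * len B) (p, X, l) 1 c'"
proof -
  have "steps P (p, X, l) (cost ins (p, X, l) + 0) c'"
    using steps.move[of "(p, X, l)" P 0 c'] assms by (auto intro: steps.stay)
  moreover have "cost ins (p, X, l) \<le> 2 * len B" by (rule cost_le) (use assms in auto)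
  ultimately show ?thesis unfolding reach_def by (metis add_0_right nat_mult_1_right)
qed

lemma reach_mono: "reach P K c n c' \<Longrightarrow> n \<le> m \<Longrightarrow> reach P K c m c'"
  unfolding reach_def by (meson le_trans mult_le_mono2)

text \<open>The factor 8 is obtained by three doublings, as the machine has no
  multiplication.\<close>

lemma reach_locate:
  assumes "fetches P p (locate a i)" "\<And>i. X i \<le> B" "8 * X i + 16 + a \<le> B" "i < 14"
  shows "\<exists>X'. reach P (2 * len B) (p, X, l) 5 (p + 5, X', l) \<and> X' 14 = 8 * X i + 16 + a \<and>
           (\<forall>j. X' j \<le> max (X j) (8 * X i + 16 + a)) \<and> (\<forall>j. j \<noteq> 14 \<longrightarrow> j \<noteq> 15 \<longrightarrow> X' j = X j)"
proof -
  let ?R = "reach P (2 * len B)"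
  define X1 where "X1 = X(14 := 2 * X i)"
  define X2 where "X2 = X(14 := 4 * X i)"
  define X3 where "X3 = X(14 := 8 * X i)"
  define X4 where "X4 = X3(15 := 16 + a)"
  define X5 where "X5 = X4(14 := 8 * X i + 16 + a)"
  note X_defs = X1_def X2_def X3_def X4_def X5_def
  have P: "p < length P" "P ! p = Add 14 i i"
    "p + 1 < length P" "P ! (p + 1) = Add 14 14 14"
    "p + 2 < length P" "P ! (p + 2) = Add 14 14 14"
    "p + 3 < length P" "P ! (p + 3) = Const 15 (16 + a)"
    "p + 4 < length P" "P ! (p + 4) = Add 14 14 15"
    using assms(1) unfolding locate_def fetches_Cons by (simp_all add: eval_nat_numeral)
  have bound: "X1 j \<le> B" "X2 j \<le> B" "X3 j \<le> B" "X4 j \<le> B" "X5 j \<le> B" for j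
    using assms(2)[of j] assms(3) by (simp_all add: X_defs fun_eq_iff)
  have "?R (p, X, l) 1 (p + 1, X1, l)"
    by (rule reach_one[OF P(1,2) assms(2)]) (simp_all add: X_defs mult_2 fun_eq_iff)
  moreover have "?R (p + 1, X1, l) 1 (p + 2, X2, l)"
    by (rule reach_one[OF P(3,4) bound(1)]) (simp_all add: X_defs fun_eq_iff)
  moreover have "?R (p + 2, X2, l) 1 (p + 3, X3, l)"
    by (rule reach_one[OF P(5,6) bound(2)]) (simp_all add: X_defs fun_eq_iff)
  moreover have "?R (p + 3, X3, l) 1 (p + 4, X4, l)"
    by (rule reach_one[OF P(7,8) bound(3)]) (use assms(3) in \<open>simp_all add: X_defs fun_eq_iff\<close>)
  moreover have "?R (p + 4, X4, l) 1 (p + 5, X5, l)"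
    by (rule reach_one[OF P(9,10) bound(4)]) (simp_all add: X_defs fun_eq_iff)
  ultimately have "?R (p, X, l) (1 + 1 + 1 + 1 + 1) (p + 5, X5, l)"
    by (blast intro: reach_trans)
  moreover have "1 + 1 + 1 + 1 + 1 = (5 :: nat)" by simp
  ultimately have "?R (p, X, l) 5 (p + 5, X5, l)" by metis
  then show ?thesis by (intro exI[of _ X5]) (simp add: X_defs)
qed

lemma represents_peak: "represents s X \<Longrightarrow> X i \<le> peak s"
  by (simp add: represents_def)

text \<open>As \<open>B\<close> bounds the final peak and peaks never decrease, one cost per
  instruction is valid throughout the run. The clock may exceed the true instruction count, as both
  branches of a test are charged alike.\<close>

lemma compile_correct:
  assumes "fetches P p (compile p c)" "wf_com c" "represents s X" "peak (exec c s) \<le> B"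
  shows "\<exists>X' n. reach P (2 * len B) (p, X, inp s) n (p + csize c, X', inp (exec c s)) \<and>
           represents (exec c s) X' \<and> clock s + n \<le> clock (exec c s)"
  using assms
proof (induction c arbitrary: p s X)
  case (VConst x c)
  have B: "X j \<le> B" for j using VConst.prems(3,4) by (auto simp: represents_def intro: le_trans)
  have "reach P (2 * len B) (p, X, inp s) 1 (p + 1, X(x := c), inp s)"
    by (rule reach_one[OF _ _ B]) (use VConst.prems in \<open>auto simp: fetches_Cons\<close>)
  moreover have "represents (exec (VConst x c) s) (X(x := c))"
    using VConst.prems(2,3)  by (auto simp: represents_def le_max_iff_disj)
  ultimately show ?case by (intro exI[of _ "X(x := c)"] exI[of _ 1]) (simp del: fun_upd_apply)
next
  case (VAdd x y z)
  have B: "X j \<le> B" for j using VAdd.prems(3,4) by (auto simp: represents_def intro: le_trans)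
  have "reach P (2 * len B) (p, X, inp s) 1 (p + 1, X(x := X y + X z), inp s)"
    by (rule reach_one[OF _ _ B]) (use VAdd.prems in \<open>auto simp: fetches_Cons\<close>)
  moreover have "represents (exec (VAdd x y z) s) (X(x := X y + X z))"
    using VAdd.prems(2,3)  by (auto simp: represents_def le_max_iff_disj)
  ultimately show ?case by (intro exI[of _ "X(x := X y + X z)"] exI[of _ 1]) (simp del: fun_upd_apply)
next
  case (VSub x y z)
  have B: "X j \<le> B" for j using VSub.prems(3,4) by (auto simp: represents_def intro: le_trans)
  have "reach P (2 * len B) (p, X, inp s) 1 (p + 1, X(x := X y - X z), inp s)"
    by (rule reach_one[OF _ _ B]) (use VSub.prems in \<open>auto simp: fetches_Cons\<close>)
  moreover have "X y - X z \<le> peak s"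
    using represents_peak[OF VSub.prems(3), of y] by simp
  moreover have "represents (exec (VSub x y z) s) (X(x := X y - X z))"
    using VSub.prems(2,3) \<open>X y - X z \<le> peak s\<close> by (auto simp: represents_def le_max_iff_disj)
  ultimately show ?case by (intro exI[of _ "X(x := X y - X z)"] exI[of _ 1]) (simp del: fun_upd_apply)
next
  case (Fetch x a i)
  have B: "X j \<le> B" for j using Fetch.prems(3,4) by (auto simp: represents_def intro: le_trans)
  have Xi: "X i = var s i" and Xa: "X (8 * j + 16 + a) = arr s a j" for j
    using Fetch.prems(2,3) by (auto simp: represents_def)
  have f: "fetches P p (locate a i)" "p + 5 < length P" "P ! (p + 5) = Load x 14"
    using Fetch.prems(1) by (simp_all add: fetches_append fetches_Cons locate_def eval_nat_numeral)
  define A where "A = 8 * var s i + 16 + a"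
  from Fetch.prems have "A \<le> B" by (simp add: A_def)
  with reach_locate[where X = X and l = "inp s", OF f(1) B] Xi Fetch.prems(2) obtain X' where X':
    "reach P (2 * len B) (p, X, inp s) 5 (p + 5, X', inp s)" "X' 14 = A"
    "\<And>j. X' j \<le> max (X j) A" "\<And>j. j \<noteq> 14 \<Longrightarrow> j \<noteq> 15 \<Longrightarrow> X' j = X j"
    unfolding A_def by auto
  have X'B: "X' j \<le> B" for j using X'(3)[of j] B[of j] \<open>A \<le> B\<close> by simp
  have X'A: "X' A = arr s a (var s i)" using X'(4)[of A] Xa unfolding A_def by simp
  have "reach P (2 * len B) (p + 5, X', inp s) 1 (p + 6, X'(x := X' A), inp s)"
    by (rule reach_one[OF f(2,3) X'B]) (simp_all add: X'(2))
  with X'(1) have run: "reach P (2 * len B) (p, X, inp s) (5 + 1) (p + 6, X'(x := X' A), inp s)"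
    by (rule reach_trans)
  have "X' j \<le> max (peak s) A" for j
    using X'(3)[of j] represents_peak[OF Fetch.prems(3), of j] by simp
  moreover have "arr s a (var s i) \<le> peak s"
    using represents_peak[OF Fetch.prems(3), of A] Xa by (simp add: A_def)
  ultimately have "represents (exec (Fetch x a i) s) (X'(x := X' A))"
    using Fetch.prems(2,3) X'(4) X'A by (auto simp: represents_def A_def le_max_iff_disj)
  then show ?case using run by (intro exI[of _ "X'(x := X' A)"] exI[of _ 6]) (simp del: fun_upd_apply)
next
  case (Put a i x)
  have B: "X j \<le> B" for j using Put.prems(3,4) by (auto simp: represents_def intro: le_trans)
  have Xi: "X i = var s i" and Xx: "X x = var s x"
    using Put.prems(2,3) by (auto simp: represents_def)
  have f: "fetches P p (locate a i)" "p + 5 < length P" "P ! (p + 5) = Store 14 x"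
    using Put.prems(1) by (simp_all add: fetches_append fetches_Cons locate_def eval_nat_numeral)
  define A where "A = 8 * var s i + 16 + a"
  from Put.prems have "A \<le> B" by (simp add: A_def)
  with reach_locate[where X = X and l = "inp s", OF f(1) B] Xi Put.prems(2) obtain X' where X':
    "reach P (2 * len B) (p, X, inp s) 5 (p + 5, X', inp s)" "X' 14 = A"
    "\<And>j. X' j \<le> max (X j) A" "\<And>j. j \<noteq> 14 \<Longrightarrow> j \<noteq> 15 \<Longrightarrow> X' j = X j"
    unfolding A_def by auto
  have X'B: "X' j \<le> B" for j using X'(3)[of j] B[of j] \<open>A \<le> B\<close> by simp
  have X'x: "X' x = var s x" using X'(4)[of x] Xx Put.prems(2) by simp
  have "reach P (2 * len B) (p + 5, X', inp s) 1 (p + 6, X'(A := var s x), inp s)"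
    by (rule reach_one[OF f(2,3) X'B]) (simp_all add: X'(2) X'x)
  with X'(1) have run: "reach P (2 * len B) (p, X, inp s) (5 + 1) (p + 6, X'(A := var s x), inp s)"
    by (rule reach_trans)
  have "X' j \<le> max (peak s) A" for j
    using X'(3)[of j] represents_peak[OF Put.prems(3), of j] by simp
  moreover have "var s x \<le> peak s" using represents_peak[OF Put.prems(3), of x] Xx by simp
  \<comment> \<open>Arrays occupy distinct residue classes modulo 8, so a write to one leaves the
    others intact.\<close>
  moreover have "8 * j + 16 + b = A \<longleftrightarrow> j = var s i \<and> b = a" if "b < 8" for j b
    using that Put.prems(2) unfolding A_def by auto presburger+
  ultimately have "represents (exec (Put a i x) s) (X'(A := var s x))"
    using Put.prems(2,3) X'(4) by (auto simp: represents_def A_def le_max_iff_disj)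
  then show ?case using run
    by (intro exI[of _ "X'(A := var s x)"] exI[of _ 6]) (simp del: fun_upd_apply)
next
  case (Input x)
  define b where "b = (case inp s of [] \<Rightarrow> 0 | b # bs \<Rightarrow> b)"
  have B: "X j \<le> B" for j
    using Input.prems(3,4) by (auto simp: represents_def split: list.splits intro: le_trans)
  have "reach P (2 * len B) (p, X, inp s) 1 (p + 1, X(x := b), inp (exec (Input x) s))"
    by (rule reach_one[OF _ _ B])
       (use Input.prems in \<open>auto simp: fetches_Cons b_def split: list.splits\<close>)
  moreover have "represents (exec (Input x) s) (X(x := b))"
    using Input.prems(2,3)  by (auto simp: represents_def le_max_iff_disj b_def split: list.splits)
  ultimately show ?case by (intro exI[of _ "X(x := b)"] exI[of _ 1]) (simp add: b_def split: list.splits del: fun_upd_apply)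
next
  case (Seq c d)
  have f: "fetches P p (compile p c)" "fetches P (p + csize c) (compile (p + csize c) d)"
    using Seq.prems(1) by (simp_all add: fetches_append)
  have w: "wf_com c" "wf_com d" using Seq.prems(2) by simp_all
  have pk: "peak (exec c s) \<le> B" "peak (exec d (exec c s)) \<le> B"
    using Seq.prems(4) peak_exec[of "exec c s" d] by simp_all
  from Seq.IH(1)[OF f(1) w(1) Seq.prems(3) pk(1)] obtain X1 n1 where 1:
    "reach P (2 * len B) (p, X, inp s) n1 (p + csize c, X1, inp (exec c s))"
    "represents (exec c s) X1" "clock s + n1 \<le> clock (exec c s)" by blast
  from Seq.IH(2)[OF f(2) w(2) 1(2) pk(2)] obtain X2 n2 where 2:
    "reach P (2 * len B) (p + csize c, X1, inp (exec c s)) n2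
       (p + csize c + csize d, X2, inp (exec d (exec c s)))"
    "represents (exec d (exec c s)) X2"
    "clock (exec c s) + n2 \<le> clock (exec d (exec c s))" by blast
  from reach_trans[OF 1(1) 2(1)] 1(3) 2(2,3) show ?case
    by (intro exI[of _ X2] exI[of _ "n1 + n2"]) (simp add: add.assoc)
next
  case (IfPos x c)
  let ?s = "tick 3 1 s"
  have X: "represents ?s X" "X x = var s x"
    using IfPos.prems(2,3) by (auto simp: represents_def le_max_iff_disj)
  have f: "p < length P" "P ! p = Jump_pos x (p + 3)"
    "p + 1 < length P" "P ! (p + 1) = Const 14 1"
    "p + 2 < length P" "P ! (p + 2) = Jump_pos 14 (p + csize c + 3)"
    "fetches P (p + 3) (compile (p + 3) c)"
    using IfPos.prems(1) by (simp_all add: fetches_append fetches_Cons eval_nat_numeral)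
  have "peak ?s \<le> B"
    using IfPos.prems(4) peak_exec[of ?s c] by (simp split: if_splits)
  then have B: "X j \<le> B" "1 \<le> B" for j
    using represents_peak[OF X(1), of j] by (auto simp: le_max_iff_disj)
  show ?case
  proof (cases "var s x > 0")
    case True
    have "reach P (2 * len B) (p, X, inp s) 1 (p + 3, X, inp s)"
      by (rule reach_one[OF f(1,2) B(1)]) (use True X(2) in simp_all)
    moreover from IfPos.IH[OF f(7) _ X(1)] True IfPos.prems(2,4) obtain X' n where
      "reach P (2 * len B) (p + 3, X, inp s) n (p + 3 + csize c, X', inp (exec c ?s))"
      "represents (exec c ?s) X'" "clock ?s + n \<le> clock (exec c ?s)" by auto
    ultimately show ?thesis using True reach_trans
      by (intro exI[of _ X'] exI[of _ "1 + n"]) (fastforce simp: ac_simps)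
  next
    case False
    let ?X = "X(14 := 1)"
    have "reach P (2 * len B) (p, X, inp s) 1 (p + 1, X, inp s)"
      by (rule reach_one[OF f(1,2) B(1)]) (use False X(2) in simp_all)
    moreover have "reach P (2 * len B) (p + 1, X, inp s) 1 (p + 2, ?X, inp s)"
      by (rule reach_one[OF f(3,4) B(1)]) (use B(2) in simp_all)
    moreover have "reach P (2 * len B) (p + 2, ?X, inp s) 1 (p + csize c + 3, ?X, inp s)"
      by (rule reach_one[OF f(5,6)]) (use B in simp_all)
    ultimately have "reach P (2 * len B) (p, X, inp s) (1 + 1 + 1) (p + csize c + 3, ?X, inp s)"
      by (blast intro: reach_trans)
    moreover have "represents ?s ?X" using X(1) by (auto simp: represents_def)
    ultimately show ?thesis using False
      by (intro exI[of _ ?X] exI[of _ "1 + 1 + 1"]) (simp add: add.assoc del: fun_upd_apply)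
  qed
next
  case (Loop x c)
  have x: "x < 14" "x \<notin> writes c" "wf_com c" using Loop.prems(2) by simp_all
  have f: "p < length P" "P ! p = Jump_pos x (p + 3)"
    "p + 1 < length P" "P ! (p + 1) = Const 14 1"
    "p + 2 < length P" "P ! (p + 2) = Jump_pos 14 (p + csize c + 7)"
    "p + 3 < length P" "P ! (p + 3) = Const 14 1"
    "p + 4 < length P" "P ! (p + 4) = Sub x x 14"
    "fetches P (p + 5) (compile (p + 5) c)"
    "p + 5 + csize c < length P" "P ! (p + 5 + csize c) = Const 14 1"
    "p + 6 + csize c < length P" "P ! (p + 6 + csize c) = Jump_pos 14 p"
    using Loop.prems(1) by (simp_all add: fetches_append fetches_Cons eval_nat_numeral)
  \<comment> \<open>An inner induction on the counter handles the remaining rounds; the outer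
    hypothesis handles the body.\<close>
  from Loop.prems(3,4) show ?case
  proof (induction "var s x" arbitrary: s X)
    case 0
    let ?X = "X(14 := 1)" and ?s = "tick 3 1 s"
    note ex = exec_Loop_0[OF 0(1)[symmetric]]
    have X: "represents ?s X" "X x = 0"
      using x(1) 0 by (auto simp: represents_def le_max_iff_disj)
    have B: "X j \<le> B" "1 \<le> B" for j
      using represents_peak[OF X(1), of j] 0(3) unfolding ex by (auto simp: le_max_iff_disj)
    have "reach P (2 * len B) (p, X, inp s) 1 (p + 1, X, inp s)"
      by (rule reach_one[OF f(1,2) B(1)]) (use X(2) in simp_all)
    moreover have "reach P (2 * len B) (p + 1, X, inp s) 1 (p + 2, ?X, inp s)"
      by (rule reach_one[OF f(3,4) B(1)]) (use B(2) in simp_all)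
    moreover have "reach P (2 * len B) (p + 2, ?X, inp s) 1 (p + csize c + 7, ?X, inp s)"
      by (rule reach_one[OF f(5,6)]) (use B in simp_all)
    ultimately have "reach P (2 * len B) (p, X, inp s) (1 + 1 + 1) (p + csize c + 7, ?X, inp s)"
      by (blast intro: reach_trans)
    moreover have "represents ?s ?X" using X(1) by (auto simp: represents_def)
    ultimately show ?case unfolding ex
      by (intro exI[of _ ?X] exI[of _ "1 + 1 + 1"]) (simp add: add.assoc del: fun_upd_apply)
  next
    case (Suc k)
    let ?s = "iter x k s" and ?X = "X(14 := 1)" and ?X' = "X(14 := 1, x := k)"
    define s' where "s' = exec c ?s"
    note ex = exec_Loop_Suc[OF x(2) Suc(2)[symmetric], folded s'_def]
    have pk: "peak ?s \<le> B" "peak (exec c ?s) \<le> B" "peak (exec (Loop x c) s') \<le> B"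
      using Suc.prems(2) peak_exec[of ?s c] peak_exec[of s' "Loop x c"] unfolding ex s'_def
      by linarith+
    then have "peak s \<le> B" "1 \<le> B" by (simp_all add: iter_def)
    then have B: "X j \<le> B" "1 \<le> B" for j
      using represents_peak[OF Suc.prems(1), of j] by simp_all
    have Xx: "X x = Suc k" using Suc.prems(1) Suc(2) x(1) by (simp add: represents_def)
    have "k \<le> peak s" using represents_peak[OF Suc.prems(1), of x] Xx by simp
    then have X': "represents ?s ?X'"
      using Suc.prems(1) x(1) by (auto simp: represents_def iter_def le_max_iff_disj)
    have "reach P (2 * len B) (p, X, inp s) 1 (p + 3, X, inp s)"
      by (rule reach_one[OF f(1,2) B(1)]) (use Xx in simp_all)
    moreover have "reach P (2 * len B) (p + 3, X, inp s) 1 (p + 4, ?X, inp s)"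
      by (rule reach_one[OF f(7,8) B(1)]) (use B(2) in simp_all)
    moreover have "reach P (2 * len B) (p + 4, ?X, inp s) 1 (p + 5, ?X', inp s)"
      by (rule reach_one[OF f(9,10)]) (use B Xx x(1) in simp_all)
    moreover have "inp ?s = inp s" by (simp add: iter_def)
    from Loop.IH[OF f(11) x(3) X' pk(2), unfolded this] obtain X1 n1 where 1:
      "reach P (2 * len B) (p + 5, ?X', inp s) n1 (p + 5 + csize c, X1, inp s')"
      "represents s' X1" "clock ?s + n1 \<le> clock s'"
      unfolding s'_def by blast
    note 1(1)
    moreover have B1: "X1 j \<le> B" for j
      using represents_peak[OF 1(2), of j] pk(2) by (simp add: s'_def)
    let ?X1 = "X1(14 := 1)"
    have "reach P (2 * len B) (p + 5 + csize c, X1, inp s') 1 (p + 6 + csize c, ?X1, inp s')"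
      by (rule reach_one[OF f(12,13) B1]) (use B(2) in simp_all)
    moreover have "reach P (2 * len B) (p + 6 + csize c, ?X1, inp s') 1 (p, ?X1, inp s')"
      by (rule reach_one[OF f(14,15)]) (use B1 B(2) in simp_all)
    moreover have "1 \<le> peak s'"
      unfolding s'_def by (rule le_trans[OF _ peak_exec]) (simp add: iter_def)
    then have "represents s' ?X1" using 1(2) by (simp add: represents_def)
    moreover have "k = var s' x"
      using exec_unchanged[OF x(2), of ?s] by (simp add: s'_def iter_def)
    moreover obtain X2 n2 where 2:
      "reach P (2 * len B) (p, ?X1, inp s') n2
        (p + csize (Loop x c), X2, inp (exec (Loop x c) s'))"
      "represents (exec (Loop x c) s') X2" "clock s' + n2 \<le> clock (exec (Loop x c) s')"
      using Suc.hyps(1)[OF \<open>k = var s' x\<close> \<open>represents s' ?X1\<close> pk(3)] by blast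
    note 2(1)
    ultimately have "reach P (2 * len B) (p, X, inp s) (1 + (1 + (1 + (n1 + (1 + (1 + n2))))))
        (p + csize (Loop x c), X2, inp (exec (Loop x c) s'))"
      by (blast intro: reach_trans)
    moreover have "clock s + (1 + (1 + (1 + (n1 + (1 + (1 + n2)))))) \<le> clock (exec (Loop x c) s')"
      using 1(3) 2(3) by (simp add: iter_def)
    ultimately show ?case unfolding ex using 2(2) by blast
  qed
qed

definition start :: "nat list \<Rightarrow> state" where
  "start l = \<lparr>var = \<lambda>_. 0, arr = \<lambda>_ _. 0, inp = l, clock = 0, peak = 0\<rparr>"

corollary ram_computes_compile:
  assumes "wf_com c" "peak (exec c (start l)) \<le> B" "clock (exec c (start l)) \<le> T"
  shows "\<exists>t\<le>2 * len B * T. ram_computes (compile 0 c) l (var (exec c (start l)) 0) t"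
proof -
  let ?P = "compile 0 c"
  have "fetches ?P 0 ?P" by (auto simp: fetches_def)
  moreover have "represents (start l) (\<lambda>_. 0)" by (simp add: represents_def start_def)
  ultimately obtain X n where X:
    "reach ?P (2 * len B) (0, \<lambda>_. 0, l) n (csize c, X, inp (exec c (start l)))"
    "represents (exec c (start l)) X" "n \<le> T"
    using compile_correct[of ?P 0 c "start l" "\<lambda>_. 0" B] assms by (auto simp: start_def)
  from reach_mono[OF X(1,3)] obtain t where t: "t \<le> 2 * len B * T"
    "steps ?P (0, \<lambda>_. 0, l) t (csize c, X, inp (exec c (start l)))"
    by (auto simp: reach_def)
  have "run ?P (0, \<lambda>_. 0, l) t (csize c, X, inp (exec c (start l)))"
    using steps_run[OF t(2)] by simp
  moreover have "X 0 = var (exec c (start l)) 0" using X(2) by (simp add: represents_def)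
  ultimately show ?thesis using t(1) unfolding ram_computes_def by blast
qed

section \<open>Weak order intervals and linear extensions\<close>

text \<open>If x is the least moved point, both \<open>q x\<close> and the preimage y of x exceed x;
  then x < y gives q x < q y = x, a contradiction. Used both for the weak order and for counting
  decreasing permutations.\<close>

lemma strict_mono_permutes_eq:
  fixes q :: "nat \<Rightarrow> nat"
  assumes "q permutes A" "strict_mono_on A q" "x \<in> A"
  shows "q x = x"
  using assms(3)
proof (induction x rule: less_induct)
  case (less x)
  obtain y where y: "y \<in> A" "q y = x"
    using permutes_image[OF assms(1)] less.prems by (metis imageE)
  have qx: "q x \<in> A" using assms(1) less.prems by (simp add: permutes_in_image)
  show ?case
  proof (rule ccontr)
    assume ne: "q x \<noteq> x"
    have "q x > x"
    proof (rule ccontr)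
      assume "\<not> q x > x"
      with ne have "q x < x" by simp
      from less.IH[OF this qx] ne show False using permutes_inj[OF assms(1)] by (auto dest: injD)
    qed
    moreover have "y > x" using less.IH[of y] y ne by (cases y x rule: linorder_cases) auto
    then have "q x < q y" using assms(2) y less.prems by (auto simp: strict_mono_on_def)
    ultimately show False using y by simp
  qed
qed

section \<open>The weak order as reverse inclusion of sets of non-inversions, taken as pairs of
  values\<close>

definition noninv :: "nat \<Rightarrow> (nat \<Rightarrow> nat) \<Rightarrow> (nat \<times> nat) set" where
  "noninv n \<sigma> = {(a, b). a \<in> {1..n} \<and> b \<in> {1..n} \<and> a < b \<and> inv \<sigma> a < inv \<sigma> b}"

lemma finite_noninv: "finite (noninv n \<sigma>)"
  by (rule finite_subset[of _ "{1..n} \<times> {1..n}"]) (auto simp: noninv_def)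

lemma transpose_adjacent_less:
  assumes "p < q" "(p, q) \<noteq> (k, k + 1)"
  shows "transpose k (k + 1) p < transpose k (k + 1) (q :: nat)"
  using assms by (auto simp: transpose_def)

lemma inv_comp_transpose:
  assumes "\<sigma> permutes S"
  shows "inv (\<sigma> \<circ> transpose k l) a = transpose k l (inv \<sigma> a)"
proof -
  have "inv (\<sigma> \<circ> transpose k l) = inv (transpose k l) \<circ> inv \<sigma>"
    using assms by (intro o_inv_distrib) (auto intro: permutes_bij)
  then show ?thesis by simp
qed

text \<open>Swapping adjacent positions changes the relative order of a single pair of values, and
  that pair is inverted in the upper permutation.\<close>

lemma weak_cover_noninv:
  assumes "weak_cover n \<sigma>\<^sub>1 \<sigma>\<^sub>2"
  shows "noninv n \<sigma>\<^sub>2 \<subseteq> noninv n \<sigma>\<^sub>1"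
proof -
  from assms obtain k where k: "\<sigma>\<^sub>1 = \<sigma>\<^sub>2 \<circ> transpose k (k + 1)" "\<sigma>\<^sub>1 k < \<sigma>\<^sub>1 (k + 1)"
    and p: "\<sigma>\<^sub>2 permutes {1..n}"
    by (auto simp: weak_cover_def)
  have "\<sigma>\<^sub>2 (k + 1) < \<sigma>\<^sub>2 k" using k by simp
  then have ne: "(inv \<sigma>\<^sub>2 a, inv \<sigma>\<^sub>2 b) \<noteq> (k, k + 1)" if "a < b" for a b
    using that permutes_inverses(1)[OF p, of a] permutes_inverses(1)[OF p, of b] by auto
  show ?thesis
    unfolding noninv_def k(1) inv_comp_transpose[OF p]
    using transpose_adjacent_less[OF _ ne] by blast
qed

lemma weak_le_noninv: "weak_le n \<rho> \<sigma> \<Longrightarrow> noninv n \<sigma> \<subseteq> noninv n \<rho>"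
  unfolding weak_le_def by (induction rule: rtranclp_induct) (auto dest: weak_cover_noninv)

text \<open>Otherwise \<open>inv \<sigma> \<circ> \<rho>\<close> increases at every adjacent pair of
  positions: at ascents of \<rho> by assumption, at descents because a pair inverted in \<rho> is
  inverted in \<sigma>. An increasing permutation is the identity, so \<rho> would equal
  \<sigma>.\<close>

lemma ex_ascent:
  assumes "\<rho> permutes {1..n}" "\<sigma> permutes {1..n}" "noninv n \<sigma> \<subseteq> noninv n \<rho>" "\<rho> \<noteq> \<sigma>"
  shows "\<exists>k. 1 \<le> k \<and> k + 1 \<le> n \<and> \<rho> k < \<rho> (k + 1) \<and> inv \<sigma> (\<rho> (k + 1)) < inv \<sigma> (\<rho> k)"
proof (rule ccontr)
  note r = permutes_inverses[OF assms(1)] permutes_in_image[OF assms(1)]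
  note s = permutes_inverses[OF assms(2)]
  assume "\<not> ?thesis"
  then have no: "\<not> (\<rho> k < \<rho> (k + 1) \<and> inv \<sigma> (\<rho> (k + 1)) < inv \<sigma> (\<rho> k))"
    if "1 \<le> k" "k + 1 \<le> n" for k using that by blast
  let ?f = "inv \<sigma> \<circ> \<rho>"
  have "inv \<sigma> permutes {1..n}" by (rule permutes_inv[OF assms(2)])
  then have f: "?f permutes {1..n}" by (rule permutes_compose[OF assms(1)])
  have adj: "?f k < ?f (k + 1)" if k: "1 \<le> k" "k + 1 \<le> n" for k
  proof (cases "\<rho> k < \<rho> (k + 1)")
    case True
    have "?f k \<noteq> ?f (k + 1)" using injD[OF permutes_inj[OF f], of k "k + 1"] by auto
    with no[OF k] True show ?thesis by simp
  next
    case False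
    have "\<rho> k \<noteq> \<rho> (k + 1)" using injD[OF permutes_inj[OF assms(1)], of k "k + 1"] by auto
    with False have lt: "\<rho> (k + 1) < \<rho> k" by simp
    have "(\<rho> (k + 1), \<rho> k) \<notin> noninv n \<rho>" by (simp add: noninv_def r)
    with assms(3) have "(\<rho> (k + 1), \<rho> k) \<notin> noninv n \<sigma>" by blast
    moreover have "\<rho> (k + 1) \<in> {1..n}" "\<rho> k \<in> {1..n}" using k r(3) by auto
    ultimately have "\<not> ?f (k + 1) < ?f k" using lt by (simp add: noninv_def)
    moreover have "?f k \<noteq> ?f (k + 1)" using injD[OF permutes_inj[OF f], of k "k + 1"] by auto
    ultimately show ?thesis by simp
  qed
  have "?f p < ?f q" if "1 \<le> p" "p < q" "q \<le> n" for p q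
    using that(2,3)
  proof (induction q)
    case (Suc q)
    show ?case
    proof (cases "p = q")
      case True
      then show ?thesis using adj[of q] that(1) Suc.prems by simp
    next
      case False
      then have "?f p < ?f q" "?f q < ?f (q + 1)"
        using Suc adj[of q] that(1) by simp_all
      then show ?thesis by simp
    qed
  qed simp
  then have "strict_mono_on {1..n} ?f" by (auto simp: strict_mono_on_def)
  from strict_mono_permutes_eq[OF f this] have "?f x = x" for x
    using permutes_not_in[OF f] by (cases "x \<in> {1..n}") blast+
  then have "\<sigma> (inv \<sigma> (\<rho> x)) = \<sigma> x" for x by simp
  then have "\<rho> = \<sigma>" by (simp add: s fun_eq_iff)
  with assms(4) show False by simp
qed

text \<open>Swapping at the ascent just found climbs one cover and loses a non-inversion; the lost
  pair is inverted in \<sigma>, so the inclusion survives.\<close>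

lemma noninv_weak_le:
  assumes "\<rho> permutes {1..n}" "\<sigma> permutes {1..n}" "noninv n \<sigma> \<subseteq> noninv n \<rho>"
  shows "weak_le n \<rho> \<sigma>"
  using assms
proof (induction "card (noninv n \<rho>)" arbitrary: \<rho> rule: less_induct)
  case less
  show ?case
  proof (cases "\<rho> = \<sigma>")
    case False
    from ex_ascent[OF less.prems this] obtain k where k: "1 \<le> k" "k + 1 \<le> n"
      "\<rho> k < \<rho> (k + 1)" "inv \<sigma> (\<rho> (k + 1)) < inv \<sigma> (\<rho> k)" by blast
    define \<rho>' where "\<rho>' = \<rho> \<circ> transpose k (k + 1)"
    have r: "inv \<rho> (\<rho> a) = a" "\<rho> (inv \<rho> a) = a" for a
      using permutes_inverses[OF less.prems(1)] by simp_all
    have p': "\<rho>' permutes {1..n}"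
      unfolding \<rho>'_def using k by (intro permutes_compose less.prems permutes_swap_id) auto
    have inv': "inv \<rho>' a = transpose k (k + 1) (inv \<rho> a)" for a
      unfolding \<rho>'_def by (rule inv_comp_transpose[OF less.prems(1)])
    have "\<rho> = \<rho>' \<circ> transpose k (k + 1)" by (simp add: \<rho>'_def comp_assoc)
    moreover have "k \<in> {1..n}" "k + 1 \<in> {1..n}" using k by simp_all
    ultimately have cover: "weak_cover n \<rho> \<rho>'"
      unfolding weak_cover_def using less.prems(1) p' k(3) by blast
    have "(\<rho> k, \<rho> (k + 1)) \<in> noninv n \<rho>"
      using k permutes_in_image[OF less.prems(1), of k]
        permutes_in_image[OF less.prems(1), of "k + 1"] by (simp add: noninv_def r)
    moreover have "(\<rho> k, \<rho> (k + 1)) \<notin> noninv n \<rho>'"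
      by (simp add: noninv_def inv' r)
    ultimately have "noninv n \<rho>' \<subset> noninv n \<rho>"
      using weak_cover_noninv[OF cover] by blast
    then have "card (noninv n \<rho>') < card (noninv n \<rho>)"
      by (intro psubset_card_mono finite_noninv)
    moreover have "noninv n \<sigma> \<subseteq> noninv n \<rho>'"
    proof clarify
      fix a b assume ab: "(a, b) \<in> noninv n \<sigma>"
      then have "(a, b) \<in> noninv n \<rho>" using less.prems(3) by blast
      then have "inv \<rho> a < inv \<rho> b" by (simp add: noninv_def)
      moreover have "(inv \<rho> a, inv \<rho> b) \<noteq> (k, k + 1)"
        using ab k(4) r(2)[of a] r(2)[of b] by (auto simp: noninv_def)
      ultimately show "(a, b) \<in> noninv n \<rho>'"
        using ab transpose_adjacent_less[of "inv \<rho> a" "inv \<rho> b" k] by (simp add: noninv_def inv')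
    qed
    ultimately have "weak_le n \<rho>' \<sigma>" by (intro less.hyps p' less.prems(2))
    with cover show ?thesis unfolding weak_le_def by (rule converse_rtranclp_into_rtranclp)
  qed (simp add: weak_le_def)
qed

text \<open>All pairs are non-inversions of the identity, so the lower end of the interval imposes
  no condition.\<close>

lemma weak_interval_eq:
  assumes "\<sigma> permutes {1..n}"
  shows "weak_interval n \<sigma> = {\<rho>. \<rho> permutes {1..n} \<and> noninv n \<sigma> \<subseteq> noninv n \<rho>}"
proof -
  have "weak_le n id \<rho>" if "\<rho> permutes {1..n}" for \<rho>
    using that by (intro noninv_weak_le permutes_id) (auto simp: noninv_def)
  then show ?thesis
    unfolding weak_interval_def using weak_le_noninv noninv_weak_le assms by blast
qed

section \<open>Linear extensions and their recursion over minimal elements\<close>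

definition precedes :: "(nat \<Rightarrow> nat) \<Rightarrow> nat \<Rightarrow> nat \<Rightarrow> bool" where
  "precedes T x y \<longleftrightarrow> y < x \<and> T x < T y"

definition lin_exts :: "(nat \<Rightarrow> nat) \<Rightarrow> nat set \<Rightarrow> nat list set" where
  "lin_exts T I = {xs. distinct xs \<and> set xs = I \<and> sorted_wrt (\<lambda>x y. \<not> precedes T y x) xs}"

definition minimals :: "(nat \<Rightarrow> nat) \<Rightarrow> nat set \<Rightarrow> nat set" where
  "minimals T I = {x \<in> I. \<forall>y\<in>I. \<not> precedes T y x}"

lemma lin_exts_subset: "lin_exts T I \<subseteq> permutations_of_set I"
  by (auto simp: lin_exts_def permutations_of_set_def)

lemma finite_lin_exts: "finite (lin_exts T I)"
  using finite_subset[OF lin_exts_subset] by simp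

lemma card_lin_exts_le: "finite I \<Longrightarrow> card (lin_exts T I) \<le> fact (card I)"
  using card_mono[OF finite_permutations_of_set lin_exts_subset] card_permutations_of_set[of I]
  by metis

lemma lin_exts_empty: "lin_exts T {} = {[]}"
  by (auto simp: lin_exts_def)

text \<open>The head of a linear extension is minimal, and any minimal element can be the
  head.\<close>

lemma lin_exts_eq:
  assumes "I \<noteq> {}"
  shows "lin_exts T I = (\<Union>x\<in>minimals T I. (#) x ` lin_exts T (I - {x}))"
proof (intro equalityI subsetI)
  fix xs assume xs: "xs \<in> lin_exts T I"
  with assms obtain x ys where "xs = x # ys" by (cases xs) (auto simp: lin_exts_def)
  with xs show "xs \<in> (\<Union>x\<in>minimals T I. (#) x ` lin_exts T (I - {x}))"
    by (fastforce simp: lin_exts_def minimals_def precedes_def)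
qed (auto simp: lin_exts_def minimals_def)

lemma card_lin_exts:
  assumes "finite I" "I \<noteq> {}"
  shows "card (lin_exts T I) = (\<Sum>x\<in>minimals T I. card (lin_exts T (I - {x})))"
proof -
  have "finite (minimals T I)" using assms(1) by (simp add: minimals_def)
  then have "card (lin_exts T I) = (\<Sum>x\<in>minimals T I. card ((#) x ` lin_exts T (I - {x})))"
    unfolding lin_exts_eq[OF assms(2)]
    by (intro card_UN_disjoint) (auto simp: finite_lin_exts)
  then show ?thesis by (simp add: card_image)
qed

text \<open>The bijection \<open>h\<close> reads \<rho> in one-line notation and replaces each value
  by its index in \<sigma>. Indices count positions from the right, whence the reversed comparison
  in \<open>precedes\<close>; a violated relation in the list is then a non-inversion of \<sigma>
  that \<rho> inverts.\<close>

lemma card_weak_interval: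
  assumes "\<sigma> permutes {1..n}"
  shows "card (weak_interval n \<sigma>) = card (lin_exts (\<lambda>x. \<sigma> (n - x)) {..<n})"
proof -
  define T where "T = (\<lambda>x. \<sigma> (n - x))"
  define h where "h \<rho> = map (\<lambda>i. n - inv \<sigma> (\<rho> (Suc i))) [0..<n]" for \<rho> :: "nat \<Rightarrow> nat"
  note s = permutes_inverses[OF assms] permutes_in_image[OF assms]
    permutes_in_image[OF permutes_inv[OF assms]]
  have inv_bounds: "1 \<le> inv \<sigma> a" "inv \<sigma> a \<le> n" if "a \<in> {1..n}" for a
    using s(4)[of a] that by auto
  have T_h: "T (n - inv \<sigma> a) = a" if "a \<in> {1..n}" for a
    using inv_bounds[OF that] by (simp add: T_def s)
  have "bij_betw h (weak_interval n \<sigma>) (lin_exts T {..<n})"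
  proof (rule bij_betw_imageI)
    have h_inj: "\<rho> i = \<rho>' i" if "h \<rho> = h \<rho>'" "\<rho> permutes {1..n}" "\<rho>' permutes {1..n}" for \<rho> \<rho>' i
    proof (cases "i \<in> {1..n}")
      case True
      then obtain j where "i = Suc j" "j < n" by (cases i) auto
      then have "h \<rho> ! (i - 1) = n - inv \<sigma> (\<rho> i)" "h \<rho>' ! (i - 1) = n - inv \<sigma> (\<rho>' i)"
        by (simp_all add: h_def)
      then have eq: "n - inv \<sigma> (\<rho> i) = n - inv \<sigma> (\<rho>' i)" using that(1) by simp
      have "\<rho> i \<in> {1..n}" "\<rho>' i \<in> {1..n}"
        using True permutes_in_image[OF that(2)] permutes_in_image[OF that(3)] by simp_all
      from T_h[OF this(1)] T_h[OF this(2)] show ?thesis unfolding eq by (rule trans[OF sym])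
    next
      case False
      with that(2,3) show ?thesis by (simp add: permutes_not_in)
    qed
    show "inj_on h (weak_interval n \<sigma>)"
      by (intro inj_onI ext h_inj) (simp_all add: weak_interval_def)
  next
    have h_in: "h \<rho> \<in> lin_exts T {..<n} \<longleftrightarrow> noninv n \<sigma> \<subseteq> noninv n \<rho>" if p: "\<rho> permutes {1..n}" for \<rho>
    proof -
      note r = permutes_inverses[OF p] permutes_in_image[OF p]
      have nth: "h \<rho> ! i = n - inv \<sigma> (\<rho> (Suc i))" "h \<rho> ! i < n" "T (h \<rho> ! i) = \<rho> (Suc i)"
        "1 \<le> inv \<sigma> (\<rho> (Suc i))" "inv \<sigma> (\<rho> (Suc i)) \<le> n"
        if "i < n" for i
      proof -
        have "\<rho> (Suc i) \<in> {1..n}" using that r(3)[of "Suc i"] by simp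
        from T_h[OF this] inv_bounds[OF this] that
        show "h \<rho> ! i = n - inv \<sigma> (\<rho> (Suc i))" "h \<rho> ! i < n" "T (h \<rho> ! i) = \<rho> (Suc i)"
          "1 \<le> inv \<sigma> (\<rho> (Suc i))" "inv \<sigma> (\<rho> (Suc i)) \<le> n"
          by (simp_all add: h_def)
      qed
      have len: "length (h \<rho>) = n" by (simp add: h_def)
      have d: "distinct (h \<rho>)"
        unfolding distinct_conv_nth len
      proof (intro allI impI)
        fix i j assume ij: "i < n" "j < n" "i \<noteq> j"
        then have "\<rho> (Suc i) \<noteq> \<rho> (Suc j)" using permutes_inj[OF p] by (auto dest: injD)
        then show "h \<rho> ! i \<noteq> h \<rho> ! j" using nth(3)[OF ij(1)] nth(3)[OF ij(2)] by metis
      qed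
      have "set (h \<rho>) \<subseteq> {..<n}" using nth(2) len by (auto simp: in_set_conv_nth)
      with distinct_card[OF d] len have set: "set (h \<rho>) = {..<n}"
        by (intro card_subset_eq) simp_all
      have "precedes T (h \<rho> ! j) (h \<rho> ! i) \<longleftrightarrow>
          \<rho> (Suc j) < \<rho> (Suc i) \<and> inv \<sigma> (\<rho> (Suc j)) < inv \<sigma> (\<rho> (Suc i))" if "i < n" "j < n" for i j
        using nth[OF that(1)] nth[OF that(2)] by (auto simp: precedes_def)
      then have "h \<rho> \<in> lin_exts T {..<n} \<longleftrightarrow> (\<forall>j<n. \<forall>i<j.
          \<not> (\<rho> (Suc j) < \<rho> (Suc i) \<and> inv \<sigma> (\<rho> (Suc j)) < inv \<sigma> (\<rho> (Suc i))))"
        by (auto simp: lin_exts_def d set len sorted_wrt_iff_nth_less)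
      also have "\<dots> \<longleftrightarrow> noninv n \<sigma> \<subseteq> noninv n \<rho>"
      proof (intro iffI allI impI notI subsetI)
        fix j i assume *: "noninv n \<sigma> \<subseteq> noninv n \<rho>" "j < n" "i < j"
          "\<rho> (Suc j) < \<rho> (Suc i) \<and> inv \<sigma> (\<rho> (Suc j)) < inv \<sigma> (\<rho> (Suc i))"
        then have "(\<rho> (Suc j), \<rho> (Suc i)) \<in> noninv n \<sigma>"
          using r(3)[of "Suc i"] r(3)[of "Suc j"] by (simp add: noninv_def)
        with *(1) have "(\<rho> (Suc j), \<rho> (Suc i)) \<in> noninv n \<rho>" by blast
        with *(3) show False by (simp add: noninv_def r)
      next
        fix ab assume *: "\<forall>j<n. \<forall>i<j.
          \<not> (\<rho> (Suc j) < \<rho> (Suc i) \<and> inv \<sigma> (\<rho> (Suc j)) < inv \<sigma> (\<rho> (Suc i)))" "ab \<in> noninv n \<sigma>"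
        obtain a b where ab: "ab = (a, b)" by fastforce
        have ab': "a \<in> {1..n}" "b \<in> {1..n}" "a < b" "inv \<sigma> a < inv \<sigma> b"
          using *(2) ab by (auto simp: noninv_def)
        define i j where "i = inv \<rho> b - 1" and "j = inv \<rho> a - 1"
        have "inv \<rho> a \<in> {1..n}" "inv \<rho> b \<in> {1..n}"
          using ab' permutes_in_image[OF permutes_inv[OF p], of a]
            permutes_in_image[OF permutes_inv[OF p], of b] by simp_all
        then have ij: "j < n" "inv \<rho> a = Suc j" "inv \<rho> b = Suc i"
          by (auto simp: i_def j_def)
        then have "\<rho> (Suc j) = a" "\<rho> (Suc i) = b" using r(1) by metis+
        with *(1) ab' ij(1) have "\<not> i < j" by metis
        moreover have "i \<noteq> j" using \<open>\<rho> (Suc j) = a\<close> \<open>\<rho> (Suc i) = b\<close> ab' by auto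
        ultimately show "ab \<in> noninv n \<rho>"
          using ab' by (simp add: ab noninv_def ij)
      qed
      finally show ?thesis .
    qed
    show "h ` weak_interval n \<sigma> = lin_exts T {..<n}"
    proof (intro equalityI subsetI)
      fix xs assume "xs \<in> h ` weak_interval n \<sigma>"
      then show "xs \<in> lin_exts T {..<n}"
        using h_in by (auto simp: weak_interval_eq[OF assms])
    next
      fix xs assume xs: "xs \<in> lin_exts T {..<n}"
      then have d: "distinct xs" "set xs = {..<n}" by (simp_all add: lin_exts_def)
      with distinct_card[OF d(1)] have len: "length xs = n" by simp
      \<comment> \<open>The inverse of \<open>h\<close>: each index is replaced by its value, and
        points outside the range are fixed.\<close>
      define \<rho> where "\<rho> i = (if i \<in> {1..n} then T (xs ! (i - 1)) else i)" for i
      have xs_n: "xs ! (i - 1) < n" if "i \<in> {1..n}" for i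
      proof -
        have "i - 1 < length xs" using that len by auto
        from nth_mem[OF this] show ?thesis unfolding d(2) by simp
      qed
      have "inj_on \<rho> {1..n}"
      proof (rule inj_onI)
        fix i j assume ij: "i \<in> {1..n}" "j \<in> {1..n}" "\<rho> i = \<rho> j"
        then have "n - xs ! (i - 1) = n - xs ! (j - 1)"
          using permutes_inj[OF assms] by (auto simp: \<rho>_def T_def dest: injD)
        then have "xs ! (i - 1) = xs ! (j - 1)" using xs_n[OF ij(1)] xs_n[OF ij(2)] by linarith
        moreover have "i - 1 < length xs" "j - 1 < length xs" using ij len by auto
        ultimately have "i - 1 = j - 1" using d(1) nth_eq_iff_index_eq by blast
        with ij show "i = j" by auto
      qed
      moreover have "\<rho> ` {1..n} \<subseteq> {1..n}"
      proof clarify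
        fix i assume i: "i \<in> {1..n}"
        have "n - xs ! (i - 1) \<in> {1..n}" using xs_n[OF i] by auto
        with i s(3) show "\<rho> i \<in> {1..n}" by (simp add: \<rho>_def T_def)
      qed
      ultimately have "bij_betw \<rho> {1..n} {1..n}"
        by (simp add: bij_betw_def endo_inj_surj)
      then have p: "\<rho> permutes {1..n}" by (rule bij_imp_permutes) (simp only: \<rho>_def if_False)
      have "h \<rho> = xs"
      proof (rule nth_equalityI)
        fix i assume "i < length (h \<rho>)"
        then have i: "i < n" by (simp add: h_def)
        then show "h \<rho> ! i = xs ! i"
          using xs_n[of "Suc i"] by (simp add: h_def \<rho>_def T_def s)
      qed (simp add: h_def len)
      moreover from this have "\<rho> \<in> weak_interval n \<sigma>"
        using xs p h_in[OF p] by (simp add: weak_interval_eq[OF assms])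
      ultimately show "xs \<in> h ` weak_interval n \<sigma>" by blast
    qed
  qed
  then show ?thesis unfolding T_def by (rule bij_betw_same_card)
qed

section \<open>A mixed radix code for unions of chain segments\<close>

text \<open>
  State of the greedy decomposition of \<open>{..<n}\<close> into chains while it scans the indices downwards
  and has reached \<open>i\<close>: \<open>w x\<close> is the weight of \<open>x\<close> (\<open>0\<close> if unassigned), \<open>W\<close> the weight of the
  chain being built, \<open>tip\<close> the value of its last element, and \<open>ord\<close> lists the \<open>p\<close> assigned
  indices in the order of assignment (\<open>p\<^sub>0\<close> of them in earlier scans). The weights are those of
  a mixed radix system whose digits are the sizes of the chain segments.
\<close>

locale peeling =
  fixes n :: nat and T :: "nat \<Rightarrow> nat" and p\<^sub>0 W :: nat and w :: "nat \<Rightarrow> nat"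
    and acc tip p :: nat and ord :: "nat \<Rightarrow> nat" and i :: nat
  assumes w_le: "w x \<le> W"
    and w_outside: "n \<le> x \<Longrightarrow> w x = 0"
    and W_eq: "W = Suc (\<Sum>y\<in>{y. y < n \<and> w y < W}. w y)"
    and w_eq: "0 < w x \<Longrightarrow> w x = Suc (\<Sum>y\<in>{y. y < n \<and> w y < w x}. w y)"
    and acc_eq: "acc = Suc (\<Sum>y<n. w y)"
    and chain: "x < y \<Longrightarrow> w x = w y \<Longrightarrow> 0 < w x \<Longrightarrow> T y < T x"
    and bij_ord: "bij_betw ord {..<p} {x. 0 < w x}"
    and ord_le: "a < b \<Longrightarrow> b < p \<Longrightarrow> w (ord a) \<le> w (ord b)"
    and ord_eq: "a < b \<Longrightarrow> b < p \<Longrightarrow> w (ord a) = w (ord b) \<Longrightarrow> ord b < ord a"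
    and blocked: "x < n \<Longrightarrow> 0 < w y \<Longrightarrow> w y < W \<Longrightarrow> w x = 0 \<or> w y < w x \<Longrightarrow>
          \<exists>z>x. w z = w y \<and> T x < T z"
    and current: "w x = W \<Longrightarrow> i \<le> x \<and> T x \<le> tip"
    and tip: "tip = 0 \<or> (\<exists>y\<ge>i. w y = W \<and> T y = tip)"
    and skipped: "i \<le> x \<Longrightarrow> x < n \<Longrightarrow> w x = 0 \<Longrightarrow> \<exists>y>x. w y = W \<and> T x < T y"
    and progress: "p\<^sub>0 \<le> p" "w x = W \<Longrightarrow> p\<^sub>0 < p"
begin

lemma W_pos: "0 < W"
  using W_eq by simp

lemma assigned: "{x. 0 < w x} \<subseteq> {..<n}" "card {x. 0 < w x} = p"
proof -
  have "x < n" if "0 < w x" for x using w_outside[of x] that by (cases "x < n") auto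
  then show "{x. 0 < w x} \<subseteq> {..<n}" by blast
  show "card {x. 0 < w x} = p" using bij_betw_same_card[OF bij_ord] by simp
qed

lemma p_le: "p \<le> n"
  using card_mono[OF _ assigned(1)] assigned(2) by simp

lemma all_assigned: "p = n \<Longrightarrow> x < n \<Longrightarrow> 0 < w x"
  using card_subset_eq[OF _ assigned(1)] assigned(2) by auto

lemma ex_unassigned: "p < n \<Longrightarrow> \<exists>x<n. w x = 0"
proof (rule ccontr)
  assume "p < n" "\<not> (\<exists>x<n. w x = 0)"
  then have "{x. 0 < w x} = {..<n}" using assigned(1) by auto
  with assigned(2) \<open>p < n\<close> show False by simp
qed

lemma W_le_acc: "W \<le> acc"
proof -
  have "(\<Sum>y\<in>{y. y < n \<and> w y < W}. w y) \<le> (\<Sum>y<n. w y)" by (rule sum_mono2) auto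
  with W_eq acc_eq show ?thesis by linarith
qed

end

lemma peeling_init: "peeling n T 0 1 (\<lambda>_. 0) 1 0 0 ord n"
  by unfold_locales (auto simp: bij_betw_def)

text \<open>If \<open>i\<close> stays unassigned, the index whose value is \<open>tip\<close> is the
  required witness. Positivity of \<open>T i\<close> rules out the default \<open>tip = 0\<close>,
  injectivity makes the comparison strict.\<close>

lemma peeling_skip:
  assumes "peeling n T p\<^sub>0 W w acc tip p ord (Suc i)"
    and T: "inj_on T {..<n}" "0 < T i" and i: "i < n" "0 < w i \<or> T i \<le> tip"
  shows "peeling n T p\<^sub>0 W w acc tip p ord i"
proof -
  interpret peeling n T p\<^sub>0 W w acc tip p ord "Suc i" by fact
  have *: "\<exists>y>i. w y = W \<and> T i < T y" if "w i = 0"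
  proof -
    from i that have "T i \<le> tip" by simp
    with T(2) tip obtain y where y: "Suc i \<le> y" "w y = W" "T y = tip" by auto
    have "y < n" using w_outside[of y] y W_pos by (cases "y < n") auto
    then have "T y \<noteq> T i" using inj_onD[OF T(1), of y i] i y by auto
    with y \<open>T i \<le> tip\<close> show ?thesis by (intro exI[of _ y]) auto
  qed
  show ?thesis
  proof
    show "\<exists>y>x. w y = W \<and> T x < T y" if "i \<le> x" "x < n" "w x = 0" for x
      using skipped[of x] * that by (cases "x = i") auto
    show "i \<le> x \<and> T x \<le> tip" if "w x = W" for x using current[OF that] by simp
    show "tip = 0 \<or> (\<exists>y\<ge>i. w y = W \<and> T y = tip)" using tip Suc_leD by blast
  qed (fact w_le w_outside W_eq w_eq acc_eq chain bij_ord ord_le ord_eq blocked progress)+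
qed

text \<open>The current chain has only indices above \<open>i\<close> and values up to
  \<open>tip\<close>, so \<open>i\<close> extends it.\<close>

lemma peeling_assign:
  assumes "peeling n T p\<^sub>0 W w acc tip p ord (Suc i)"
    and i: "i < n" "w i = 0" "tip < T i"
  shows "peeling n T p\<^sub>0 W (w(i := W)) (acc + W) (T i) (Suc p) (ord(p := i)) i"
proof -
  interpret peeling n T p\<^sub>0 W w acc tip p ord "Suc i" by fact
  let ?w = "w(i := W)" and ?ord = "ord(p := i)"
  \<comment> \<open>The equation for a weight involves only strictly smaller weights, so a further
    index of weight \<open>W\<close>, the largest in use, disturbs none of them.\<close>
  have sums: "(\<Sum>y\<in>{y. y < n \<and> ?w y < v}. ?w y) = (\<Sum>y\<in>{y. y < n \<and> w y < v}. w y)"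
    if "v \<le> W" for v
  proof (rule sum.mono_neutral_cong_left)
    show "{y. y < n \<and> ?w y < v} \<subseteq> {y. y < n \<and> w y < v}" using that i(2) by auto
    show "\<forall>y\<in>{y. y < n \<and> w y < v} - {y. y < n \<and> ?w y < v}. w y = 0"
      using i(2) by auto
    show "?w y = w y" if "y \<in> {y. y < n \<and> ?w y < v}" for y
      using that \<open>v \<le> W\<close> by (auto split: if_splits)
  qed simp
  have ord_pos: "0 < w (ord q)" if "q < p" for q
    using bij_ord that by (auto simp: bij_betw_def)
  have ord_ne: "ord q \<noteq> i" if "q < p" for q using ord_pos[OF that] i(2) by auto
  show ?thesis
  proof
    show "?w x \<le> W" for x using w_le[of x] by simp
    show "?w x = 0" if "n \<le> x" for x using w_outside[OF that] that i(1) by simp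
    show "W = Suc (\<Sum>y\<in>{y. y < n \<and> ?w y < W}. ?w y)" using W_eq sums[of W] by simp
    show "?w x = Suc (\<Sum>y\<in>{y. y < n \<and> ?w y < ?w x}. ?w y)" if "0 < ?w x" for x
      using sums[of W] W_eq sums[of "w x"] w_eq[of x] w_le[of x] that by (cases "x = i") auto
    have "(\<Sum>y<n. ?w y) = (\<Sum>y\<in>{..<n} - {i}. w y) + W"
      using i(1) by (subst sum.remove[of _ i]) auto
    moreover have "(\<Sum>y<n. w y) = (\<Sum>y\<in>{..<n} - {i}. w y)"
      using i by (subst sum.remove[of _ i]) auto
    ultimately show "acc + W = Suc (\<Sum>y<n. ?w y)" by (simp add: acc_eq)
    show "T y < T x" if "x < y" "?w x = ?w y" "0 < ?w x" for x y
    proof (cases "x = i \<or> y = i")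
      case True
      then show ?thesis using that current[of x] current[of y] i(3) by (auto split: if_splits)
    next
      case False
      then show ?thesis using that chain[of x y] by simp
    qed
    have "{x. 0 < ?w x} = insert i {x. 0 < w x}" using W_pos by auto
    moreover have "bij_betw ?ord {..<p} {x. 0 < w x}"
      using bij_ord by (subst bij_betw_cong[of _ _ ord]) auto
    then have "bij_betw ?ord (insert p {..<p}) (insert i {x. 0 < w x})"
      using notIn_Un_bij_betw[of p "{..<p}" ?ord "{x. 0 < w x}"] i(2) by simp
    moreover have "insert p {..<p} = {..<Suc p}" by auto
    ultimately show "bij_betw ?ord {..<Suc p} {x. 0 < ?w x}" by simp
    show "?w (?ord a) \<le> ?w (?ord b)" if "a < b" "b < Suc p" for a b
    proof (cases "b = p")
      case False
      then show ?thesis using that ord_ne[of a] ord_ne[of b] ord_le[of a b] by simp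
    qed (use w_le in auto)
    show "?ord b < ?ord a" if "a < b" "b < Suc p" "?w (?ord a) = ?w (?ord b)" for a b
    proof (cases "b = p")
      case True
      then show ?thesis using that ord_ne[of a] current[of "ord a"] by auto
    next
      case False
      then show ?thesis using that ord_ne[of a] ord_ne[of b] ord_eq[of a b] by simp
    qed
    show "\<exists>z>x. ?w z = ?w y \<and> T x < T z"
      if "x < n" "0 < ?w y" "?w y < W" "?w x = 0 \<or> ?w y < ?w x" for x y
    proof -
      have "y \<noteq> i" using that by auto
      with that have y: "0 < w y" "w y < W" "?w y = w y" by auto
      have "w x = 0 \<or> w y < w x" using that(4) y i(2) by (auto split: if_splits)
      from blocked[OF that(1) y(1,2) this] obtain z where z: "z > x" "w z = w y" "T x < T z"
        by blast
      have "z \<noteq> i" using z y i(2) by auto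
      with z y show ?thesis by auto
    qed
    show "i \<le> x \<and> T x \<le> T i" if "?w x = W" for x
      using that current[of x] i(3) by (cases "x = i") auto
    show "T i = 0 \<or> (\<exists>y\<ge>i. ?w y = W \<and> T y = T i)" by auto
    show "\<exists>y>x. ?w y = W \<and> T x < T y" if "i \<le> x" "x < n" "?w x = 0" for x
    proof -
      have "x \<noteq> i" using that W_pos by auto
      with that skipped[of x] obtain y where "y > x" "w y = W" "T x < T y" by auto
      then show ?thesis by (intro exI[of _ y]) simp
    qed
    show "p\<^sub>0 \<le> Suc p" "p\<^sub>0 < Suc p" using progress(1) by simp_all
  qed
qed

text \<open>A completed scan covers all indices, so \<open>skipped\<close> now supplies the
  witnesses of \<open>blocked\<close> for the finished chain, and \<open>acc\<close> exceeds all
  weights in use.\<close>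

lemma peeling_round:
  assumes "peeling n T p\<^sub>0 W w acc tip p ord 0"
  shows "peeling n T p acc w acc 0 p ord n" "w x < acc"
proof -
  interpret peeling n T p\<^sub>0 W w acc tip p ord 0 by fact
  have lt: "w x < acc" for x
  proof (cases "x < n")
    case True
    then have "w x \<le> (\<Sum>y<n. w y)" by (intro member_le_sum) auto
    then show ?thesis by (simp add: acc_eq)
  qed (simp add: w_outside acc_eq)
  then show "w x < acc" .
  have "{y. y < n \<and> w y < acc} = {..<n}" using lt by auto
  show "peeling n T p acc w acc 0 p ord n"
  proof
    show "acc = Suc (\<Sum>y\<in>{y. y < n \<and> w y < acc}. w y)"
      unfolding \<open>_ = {..<n}\<close> by (rule acc_eq)
    show "\<exists>z>x. w z = w y \<and> T x < T z" if "x < n" "0 < w y" "w x = 0 \<or> w y < w x" for x y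
    proof (cases "w y < W")
      case False
      with w_le[of y] w_le[of x] that(3) have "w y = W" "w x = 0" by auto
      with skipped that(1) show ?thesis by auto
    qed (use blocked that in blast)
    show "w x \<le> acc" for x using lt[of x] by simp
    show "n \<le> x \<and> T x \<le> 0" "p < p" if "w x = acc" for x using lt[of x] that by simp_all
  qed (simp_all add: w_outside w_eq[symmetric] acc_eq[symmetric] chain bij_ord ord_le ord_eq)
qed

text \<open>What the completed peeling has to provide. By \<open>blocked\<close>, every element has
  a larger element to its left in each earlier chain; this is where decreasing subsequences come
  from.\<close>

locale coding =
  fixes n :: nat and T w ord :: "nat \<Rightarrow> nat"
  assumes inj_T: "inj_on T {..<n}"
    and T_bounds: "x < n \<Longrightarrow> 0 < T x \<and> T x \<le> n"
    and weight: "x < n \<Longrightarrow> w x = Suc (\<Sum>y\<in>{y. y < n \<and> w y < w x}. w y)"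
    and chain: "x < y \<Longrightarrow> y < n \<Longrightarrow> w x = w y \<Longrightarrow> T y < T x"
    and bij_ord: "bij_betw ord {..<n} {..<n}"
    and ord_le: "a < b \<Longrightarrow> b < n \<Longrightarrow> w (ord a) \<le> w (ord b)"
    and ord_eq: "a < b \<Longrightarrow> b < n \<Longrightarrow> w (ord a) = w (ord b) \<Longrightarrow> ord b < ord a"
    and blocked: "x < n \<Longrightarrow> y < n \<Longrightarrow> w y < w x \<Longrightarrow> \<exists>z>x. z < n \<and> w z = w y \<and> T x < T z"

text \<open>With \<open>W\<close> above every weight and no weight 0, the side conditions in
  \<open>blocked\<close> reduce to comparing two chains.\<close>

lemma peeling_coding:
  assumes "peeling n T p\<^sub>0 W w acc tip p ord n"
    and T: "inj_on T {..<n}" "\<And>x. x < n \<Longrightarrow> 0 < T x \<and> T x \<le> n"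
    and pos: "\<And>x. x < n \<Longrightarrow> 0 < w x" and lt: "\<And>x. w x < W"
  shows "coding n T w ord"
proof -
  interpret peeling n T p\<^sub>0 W w acc tip p ord n by fact
  have out: "x < n" if "0 < w x" for x using w_outside[of x] that by (cases "x < n") auto
  with pos have n: "{x. 0 < w x} = {..<n}" by auto
  with bij_ord have "p = n" using bij_betw_same_card by fastforce
  show ?thesis
  proof
    show "w x = Suc (\<Sum>y\<in>{y. y < n \<and> w y < w x}. w y)" if "x < n" for x
      using w_eq pos that by blast
    show "T y < T x" if "x < y" "y < n" "w x = w y" for x y using chain[of x y] pos that by simp
    show "bij_betw ord {..<n} {..<n}" using bij_ord n \<open>p = n\<close> by simp
    show "w (ord a) \<le> w (ord b)" if "a < b" "b < n" for a b using ord_le that \<open>p = n\<close> by blast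
    show "ord b < ord a" if "a < b" "b < n" "w (ord a) = w (ord b)" for a b
      using ord_eq that \<open>p = n\<close> by blast
    show "\<exists>z>x. z < n \<and> w z = w y \<and> T x < T z" if "x < n" "y < n" "w y < w x" for x y
    proof -
      from blocked[OF that(1) pos[OF that(2)] lt] that(3)
      obtain z where z: "z > x" "w z = w y" "T x < T z" by blast
      then have "z < n" using out[of z] pos[OF that(2)] by simp
      with z show ?thesis by blast
    qed
  qed (fact T)+
qed

section \<open>Codes of unions of chain segments\<close>

context coding
begin

lemma weight_pos: "x < n \<Longrightarrow> 0 < w x"
  using weight by (metis zero_less_Suc)

text \<open>On a chain a smaller index is a later position with a larger value, so closure towards
  smaller indices describes end segments of the poset chain.\<close>

definition closed :: "nat set \<Rightarrow> bool" where
  "closed I \<longleftrightarrow> I \<subseteq> {..<n} \<and> (\<forall>x y. x < y \<longrightarrow> w x = w y \<longrightarrow> y \<in> I \<longrightarrow> x \<in> I)"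

lemma finite_closed: "closed I \<Longrightarrow> finite I"
  unfolding closed_def using finite_subset by blast

lemma closed_all: "closed {..<n}"
  by (auto simp: closed_def)

text \<open>The heaviest index in which two codes differ outweighs all lighter indices together.\<close>

lemma code_less:
  assumes "closed I" "closed J" "x \<in> J - I"
    and max: "\<And>y. y \<in> (I - J) \<union> (J - I) \<Longrightarrow> w y \<le> w x"
  shows "sum w I < sum w J"
proof -
  have fin: "finite I" "finite J" using assms(1,2) finite_closed by blast+
  \<comment> \<open>Equal weights would put x and y on one chain, where the segments of two closed
    sets are nested.\<close>
  have "w y < w x" if "y \<in> I - J" for y
  proof (rule ccontr)
    assume "\<not> w y < w x"
    with max[of y] that have "w y = w x" by simp
    moreover have "y \<noteq> x" using that assms(3) by blast
    ultimately show False using that assms(1-3) unfolding closed_def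
      by (metis DiffD1 DiffD2 linorder_neqE_nat)
  qed
  then have "I - J \<subseteq> {y. y < n \<and> w y < w x}" using assms(1) by (auto simp: closed_def)
  then have "sum w (I - J) \<le> (\<Sum>y\<in>{y. y < n \<and> w y < w x}. w y)" by (intro sum_mono2) auto
  also have "\<dots> < w x" using weight[of x] assms(2,3) by (auto simp: closed_def)
  also have "w x \<le> sum w (J - I)" using assms(3) fin by (intro member_le_sum) auto
  finally have "sum w (I - J) < sum w (J - I)" .
  moreover have "sum w I = sum w (I \<inter> J) + sum w (I - J)"
    by (rule sum.Int_Diff[OF fin(1)])
  moreover have "sum w J = sum w (I \<inter> J) + sum w (J - I)"
    using sum.Int_Diff[OF fin(2), of w I] by (simp add: Int_commute)
  ultimately show ?thesis by simp
qed

lemma code_inj: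
  assumes "closed I" "closed J" "sum w I = sum w J"
  shows "I = J"
proof (rule ccontr)
  define D where "D = (I - J) \<union> (J - I)"
  assume "I \<noteq> J"
  then have "D \<noteq> {}" "finite D" using assms(1,2) finite_closed by (auto simp: D_def)
  then have "Max (w ` D) \<in> w ` D" by (intro Max_in) auto
  then obtain x where "x \<in> D" "Max (w ` D) = w x" by blast
  with \<open>finite D\<close> have x: "x \<in> D" "\<And>y. y \<in> D \<Longrightarrow> w y \<le> w x"
    using Max_ge[of "w ` D"] by auto
  then have "x \<in> J - I \<or> x \<in> I - J" by (auto simp: D_def)
  then have "sum w I < sum w J \<or> sum w J < sum w I"
    using code_less[OF assms(1,2), of x] code_less[OF assms(2,1), of x] x(2)
    unfolding D_def by (metis Un_commute)
  with assms(3) show False by simp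
qed

text \<open>Adding a chain of s elements of weight v, where v is one more than the sum of the
  lighter weights, turns v into v + s * v = v * (s + 1).\<close>

lemma code_Suc_prod:
  "Suc (\<Sum>x<n. w x) = (\<Prod>v\<in>w ` {..<n}. Suc (card {x. x < n \<and> w x = v}))"
proof -
  have "Suc (\<Sum>x\<in>{x. x < n \<and> w x \<le> v}. w x) =
      (\<Prod>v'\<in>{v' \<in> w ` {..<n}. v' \<le> v}. Suc (card {x. x < n \<and> w x = v'}))" for v
  proof (induction v rule: less_induct)
    case (less v)
    show ?case
    proof (cases "v \<in> w ` {..<n}")
      case True
      then obtain x where x: "x < n" "w x = v" by auto
      let ?L = "{y. y < n \<and> w y < v}"
      have L: "Suc (sum w ?L) = v" using weight[OF x(1)] x(2) by simp
      have prod: "Suc (sum w ?L) = (\<Prod>v'\<in>{v' \<in> w ` {..<n}. v' < v}. Suc (card {x. x < n \<and> w x = v'}))"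
      proof -
        have "v > 0" using weight_pos x by blast
        then have "?L = {y. y < n \<and> w y \<le> v - 1}" "{v' \<in> w ` {..<n}. v' < v} = {v' \<in> w ` {..<n}. v' \<le> v - 1}"
          by auto
        with less[of "v - 1"] \<open>v > 0\<close> show ?thesis by simp
      qed
      have "{y. y < n \<and> w y \<le> v} = ?L \<union> {y. y < n \<and> w y = v}" by auto
      then have "sum w {y. y < n \<and> w y \<le> v} = sum w ?L + sum w {y. y < n \<and> w y = v}"
        by (simp add: sum.union_disjoint disjoint_iff)
      also have "sum w {y. y < n \<and> w y = v} = card {y. y < n \<and> w y = v} * v" by simp
      finally have "Suc (sum w {y. y < n \<and> w y \<le> v}) = Suc (sum w ?L) + card {y. y < n \<and> w y = v} * v"
        by simp
      also have "\<dots> = Suc (sum w ?L) * Suc (card {y. y < n \<and> w y = v})" unfolding L by simp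
      finally have "Suc (sum w {y. y < n \<and> w y \<le> v}) = \<dots>" .
      moreover have "{v' \<in> w ` {..<n}. v' \<le> v} = insert v {v' \<in> w ` {..<n}. v' < v}"
        using True by auto
      ultimately show ?thesis using prod by simp
    next
      case False
      show ?thesis
      proof (cases v)
        case 0
        have no: "{x. x < n \<and> w x \<le> 0} = {}" "{v' \<in> w ` {..<n}. v' \<le> 0} = {}"
          by (auto dest!: weight_pos)
        show ?thesis unfolding 0 no by simp
      next
        case (Suc u)
        have "w x \<noteq> Suc u" if "x < n" for x using False Suc that by (metis imageI lessThan_iff)
        then have "{x. x < n \<and> w x \<le> v} = {x. x < n \<and> w x \<le> u}"
          "{v' \<in> w ` {..<n}. v' \<le> v} = {v' \<in> w ` {..<n}. v' \<le> u}"
          using Suc le_Suc_eq by auto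
        with less[of u] Suc show ?thesis by simp
      qed
    qed
  qed
  note * = this[of "Max (w ` {..<n})"]
  have "w x \<le> Max (w ` {..<n})" if "x < n" for x using that by simp
  then have "{x. x < n \<and> w x \<le> Max (w ` {..<n})} = {..<n}"
    "{v' \<in> w ` {..<n}. v' \<le> Max (w ` {..<n})} = w ` {..<n}" by auto
  with * show ?thesis by simp
qed

text \<open>Starting from x, \<open>blocked\<close> is followed down through the lighter chains;
  indices and values grow along the way, so one element per chain is collected.\<close>

lemma ex_antichain:
  assumes "x < n"
  shows "\<exists>C\<subseteq>{x..<n}. strict_mono_on C T \<and> card C = card {v \<in> w ` {..<n}. v \<le> w x} \<and>
           (\<forall>y\<in>C. T x \<le> T y)"
  using assms
proof (induction "w x" arbitrary: x rule: less_induct)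
  case less
  let ?V = "{v \<in> w ` {..<n}. v < w x}"
  have V: "{v \<in> w ` {..<n}. v \<le> w x} = insert (w x) ?V" using less.prems by auto
  have fin: "finite ?V" by simp
  show ?case
  proof (cases "?V = {}")
    case True
    then show ?thesis unfolding V using less.prems
      by (intro exI[of _ "{x}"]) (auto simp: strict_mono_on_def)
  next
    case False
    \<comment> \<open>The next lighter chain is taken, so that none is left out of the
      count.\<close>
    with fin have "Max ?V \<in> ?V" by (rule Max_in)
    then obtain y where y: "y < n" "w y = Max ?V" "w y < w x" by auto
    from blocked[OF less.prems y(1,3)] obtain z where
      z: "z > x" "z < n" "w z = w y" "T x < T z" by blast
    from less.hyps[of z] z y obtain C where C: "C \<subseteq> {z..<n}" "strict_mono_on C T"
      "card C = card {v \<in> w ` {..<n}. v \<le> w z}" "\<And>u. u \<in> C \<Longrightarrow> T z \<le> T u" by auto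
    have "{v \<in> w ` {..<n}. v \<le> w z} = ?V"
      using z y fin Max_ge[OF fin] by (auto intro: le_less_trans)
    then have "card C = card ?V" using C(3) by simp
    moreover have "x \<notin> C" "finite C" using C(1) z finite_subset by auto
    ultimately have "card (insert x C) = card {v \<in> w ` {..<n}. v \<le> w x}"
      unfolding V using fin by simp
    moreover have "strict_mono_on (insert x C) T"
      using C z by (fastforce simp: strict_mono_on_def)
    moreover have "insert x C \<subseteq> {x..<n}" using C z less.prems by auto
    moreover have "\<forall>u\<in>insert x C. T x \<le> T u" using C(4) z(4) by fastforce
    ultimately show ?thesis by blast
  qed
qed

lemma ex_antichain_card: "\<exists>C\<subseteq>{..<n}. strict_mono_on C T \<and> card C = card (w ` {..<n})"
proof (cases "n = 0")
  case False
  then have "Max (w ` {..<n}) \<in> w ` {..<n}" by (intro Max_in) auto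
  then obtain x where x: "x < n" "w x = Max (w ` {..<n})" by auto
  then have "{v \<in> w ` {..<n}. v \<le> w x} = w ` {..<n}" by auto
  with ex_antichain[OF x(1)] obtain C where
    "C \<subseteq> {x..<n}" "strict_mono_on C T" "card C = card (w ` {..<n})" by auto
  then show ?thesis by (intro exI[of _ C]) auto
qed (auto simp: strict_mono_on_def)

text \<open>Greedy decoding from the heaviest index down: positions from \<open>p\<close> on in
  \<open>ord\<close> are decided, \<open>J\<close> holds those taken, and \<open>r\<close> is left
  to represent. An index not taken outweighs \<open>r\<close>; this makes the taken part of each
  chain a segment in the order of decoding.\<close>

definition decode_inv :: "nat \<Rightarrow> nat \<Rightarrow> nat \<Rightarrow> nat set \<Rightarrow> bool" where
  "decode_inv m p r J \<longleftrightarrow> J \<subseteq> ord ` {p..<n} \<and> r + sum w J = m \<and> r \<le> (\<Sum>q<p. w (ord q)) \<and>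
     (\<forall>a. p \<le> a \<longrightarrow> a < n \<longrightarrow> ord a \<notin> J \<longrightarrow> r < w (ord a)) \<and>
     (\<forall>a b. p \<le> b \<longrightarrow> b < a \<longrightarrow> a < n \<longrightarrow> w (ord a) = w (ord b) \<longrightarrow> ord b \<in> J \<longrightarrow> ord a \<in> J)"

lemma sum_ord: "(\<Sum>q<n. w (ord q)) = (\<Sum>x<n. w x)"
  by (rule sum.reindex_bij_betw[OF bij_ord])

lemma decode_init: "m \<le> (\<Sum>x<n. w x) \<Longrightarrow> decode_inv m n m {}"
  by (simp add: decode_inv_def sum_ord)

lemma ord_inj: "a < n \<Longrightarrow> b < n \<Longrightarrow> ord a = ord b \<Longrightarrow> a = b"
  using bij_ord by (auto simp: bij_betw_def dest: inj_onD)

text \<open>An index of the same chain decided earlier must have been taken too, as otherwise its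
  weight, which equals \<open>w (ord p)\<close>, would exceed \<open>r\<close>.\<close>

lemma decode_take:
  assumes "decode_inv m (Suc p) r J" "p < n" "w (ord p) \<le> r"
  shows "decode_inv m p (r - w (ord p)) (insert (ord p) J)"
proof -
  have 1: "J \<subseteq> ord ` {Suc p..<n}" "r + sum w J = m" "r \<le> (\<Sum>q<Suc p. w (ord q))"
    and 2: "\<And>a. Suc p \<le> a \<Longrightarrow> a < n \<Longrightarrow> ord a \<notin> J \<Longrightarrow> r < w (ord a)"
    and 3: "\<And>a b. Suc p \<le> b \<Longrightarrow> b < a \<Longrightarrow> a < n \<Longrightarrow> w (ord a) = w (ord b) \<Longrightarrow> ord b \<in> J \<Longrightarrow> ord a \<in> J"
    using assms(1) unfolding decode_inv_def by blast+
  have "ord p \<notin> J"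
  proof
    assume "ord p \<in> J"
    with 1(1) obtain q where "ord p = ord q" "Suc p \<le> q" "q < n" by auto
    with ord_inj[of p q] assms(2) show False by simp
  qed
  moreover have "finite J" using 1(1) finite_subset by blast
  ultimately have "r - w (ord p) + sum w (insert (ord p) J) = m" using 1(2) assms(3) by simp
  moreover have "insert (ord p) J \<subseteq> ord ` {p..<n}"
  proof -
    have "{p..<n} = insert p {Suc p..<n}" using assms(2) by auto
    with 1(1) show ?thesis by auto
  qed
  moreover have "r - w (ord p) \<le> (\<Sum>q<p. w (ord q))" using 1(3) by simp
  moreover have "r - w (ord p) < w (ord a)" if "p \<le> a" "a < n" "ord a \<notin> insert (ord p) J" for a
  proof -
    have "a \<noteq> p" using that by auto
    with that 2[of a] show ?thesis by simp
  qed
  moreover have "ord a \<in> insert (ord p) J"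
    if "p \<le> b" "b < a" "a < n" "w (ord a) = w (ord b)" "ord b \<in> insert (ord p) J" for a b
  proof (cases "b = p")
    case True
    with that 2[of a] assms(3) show ?thesis by (metis Suc_leI insertCI not_le)
  next
    case False
    moreover from this that assms(2) ord_inj[of b p] have "ord b \<in> J" by auto
    ultimately show ?thesis using that 3[of b a] by simp
  qed
  ultimately show ?thesis unfolding decode_inv_def by blast
qed

text \<open>The remainder stays representable: it is at most the sum of the weights below
  \<open>w (ord p)\<close>, and all indices carrying those come before \<open>p\<close> in
  \<open>ord\<close>.\<close>

lemma decode_skip:
  assumes "decode_inv m (Suc p) r J" "p < n" "r < w (ord p)"
  shows "decode_inv m p r J"
proof -
  have 1: "J \<subseteq> ord ` {Suc p..<n}" "r + sum w J = m"
    and 2: "\<And>a. Suc p \<le> a \<Longrightarrow> a < n \<Longrightarrow> ord a \<notin> J \<Longrightarrow> r < w (ord a)"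
    and 3: "\<And>a b. Suc p \<le> b \<Longrightarrow> b < a \<Longrightarrow> a < n \<Longrightarrow> w (ord a) = w (ord b) \<Longrightarrow> ord b \<in> J \<Longrightarrow> ord a \<in> J"
    using assms(1) unfolding decode_inv_def by blast+
  have "ord p \<notin> J"
  proof
    assume "ord p \<in> J"
    with 1(1) obtain q where "ord p = ord q" "Suc p \<le> q" "q < n" by auto
    with ord_inj[of p q] assms(2) show False by simp
  qed
  have "ord p < n" using bij_ord assms(2) by (auto simp: bij_betw_def)
  have "{y. y < n \<and> w y < w (ord p)} \<subseteq> ord ` {..<p}"
  proof clarify
    fix y assume y: "y < n" "w y < w (ord p)"
    then obtain q where q: "q < n" "y = ord q" using bij_ord by (auto simp: bij_betw_def)
    have "\<not> p \<le> q" using q y ord_le[of p q] by (cases "p = q") auto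
    with q show "y \<in> ord ` {..<p}" by simp
  qed
  then have "(\<Sum>y\<in>{y. y < n \<and> w y < w (ord p)}. w y) \<le> sum w (ord ` {..<p})"
    by (intro sum_mono2) auto
  also have "\<dots> = (\<Sum>q<p. w (ord q))"
    using ord_inj assms(2) by (intro sum.reindex_cong[of ord]) (auto simp: inj_on_def)
  finally have "r \<le> (\<Sum>q<p. w (ord q))"
    using weight[OF \<open>ord p < n\<close>] assms(3) by linarith
  moreover have "J \<subseteq> ord ` {p..<n}" using 1(1) by (rule order_trans) auto
  moreover have "r < w (ord a)" if "p \<le> a" "a < n" "ord a \<notin> J" for a
    using 2[of a] that assms(3) by (cases "a = p") auto
  moreover have "ord a \<in> J"
    if "p \<le> b" "b < a" "a < n" "w (ord a) = w (ord b)" "ord b \<in> J" for a b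
    using 3[of b a] that \<open>ord p \<notin> J\<close> by (cases "b = p") auto
  ultimately show ?thesis unfolding decode_inv_def using 1(2) by blast
qed

text \<open>The remainder is bounded by an empty sum and so vanishes. Decoding visits a chain in
  increasing order of indices, hence the taken segments are closed.\<close>

lemma decode_final:
  assumes "decode_inv m 0 r J"
  shows "closed J" "sum w J = m"
proof -
  have 1: "J \<subseteq> ord ` {..<n}" "r + sum w J = m" "r \<le> 0"
    and 3: "\<And>a b. b < a \<Longrightarrow> a < n \<Longrightarrow> w (ord a) = w (ord b) \<Longrightarrow> ord b \<in> J \<Longrightarrow> ord a \<in> J"
    using assms unfolding decode_inv_def by (auto simp: atLeast0LessThan)
  then show "sum w J = m" by simp
  have onto: "ord ` {..<n} = {..<n}" using bij_ord by (simp add: bij_betw_def)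
  show "closed J"
    unfolding closed_def
  proof (intro conjI allI impI)
    show "J \<subseteq> {..<n}" using 1(1) onto by simp
    fix x y assume xy: "x < y" "w x = w y" "y \<in> J"
    then have "y < n" using \<open>J \<subseteq> {..<n}\<close> by auto
    with xy(1) have "x \<in> ord ` {..<n}" "y \<in> ord ` {..<n}" using onto by auto
    then obtain a b where ab: "a < n" "x = ord a" "b < n" "y = ord b" by auto
    then have "\<not> a < b" "a \<noteq> b" using ord_eq[of a b] xy by auto
    then show "x \<in> J" using 3[of b a] ab xy by simp
  qed
qed

text \<open>Any larger index of I on the chain of x would precede x, so a minimal x is the last
  index of its segment. Its weight is positive, hence the recursion only looks up smaller
  codes.\<close>

lemma closed_remove:
  assumes "closed I" "x \<in> minimals T I"
  shows "closed (I - {x})" "sum w (I - {x}) = sum w I - w x" "sum w (I - {x}) < sum w I"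
proof -
  have x: "x \<in> I" "x < n" "\<And>y. y \<in> I \<Longrightarrow> \<not> (x < y \<and> T y < T x)"
    using assms by (auto simp: minimals_def precedes_def closed_def)
  have "x \<noteq> x'" if "x' < y" "w x' = w y" "y \<in> I" for x' y
    using that x(3)[of y] chain[of x' y] assms(1) by (auto simp: closed_def)
  then show "closed (I - {x})" using assms(1) unfolding closed_def by blast
  have "sum w I = w x + sum w (I - {x})"
    using x finite_closed[OF assms(1)] by (intro sum.remove)
  with weight_pos[OF x(2)] show "sum w (I - {x}) = sum w I - w x" "sum w (I - {x}) < sum w I"
    by simp_all
qed

section \<open>Filling the table by scanning for minimal elements\<close>

definition table_inv :: "nat \<Rightarrow> (nat \<Rightarrow> nat) \<Rightarrow> bool" where
  "table_inv m F \<longleftrightarrow> (\<forall>I. closed I \<longrightarrow> sum w I < m \<longrightarrow> F (sum w I) = card (lin_exts T I))"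

lemma table_init:
  assumes "F 0 = 1"
  shows "table_inv 1 F"
  unfolding table_inv_def
proof (intro allI impI)
  fix I assume I: "closed I" "sum w I < 1"
  then have "I = {}"
    using weight_pos finite_closed[OF I(1)] by (auto simp: closed_def subset_iff) (metis less_irrefl)
  with assms show "F (sum w I) = card (lin_exts T I)" by (simp add: lin_exts_empty)
qed

text \<open>Indices are scanned downwards, that is, positions from left to right. An element of
  \<open>I\<close> is minimal iff its value is below all values of \<open>I\<close> seen before, so
  the running minimum \<open>mn\<close> suffices to find the minimal elements; \<open>Suc n\<close>,
  above all values, means that none was seen.\<close>

definition scan_inv :: "(nat \<Rightarrow> nat) \<Rightarrow> nat set \<Rightarrow> nat \<Rightarrow> nat \<Rightarrow> nat \<Rightarrow> bool" where
  "scan_inv F I i mn acc \<longleftrightarrow> mn \<le> Suc n \<and>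
     acc = (\<Sum>x\<in>{x \<in> minimals T I. i \<le> x}. F (sum w I - w x)) \<and>
     (\<forall>x\<in>I. i \<le> x \<longrightarrow> mn \<le> T x) \<and> (mn = Suc n \<or> (\<exists>x\<in>I. i \<le> x \<and> T x = mn))"

lemma scan_init: "closed I \<Longrightarrow> scan_inv F I n (Suc n) 0"
proof -
  assume "closed I"
  then have "\<not> n \<le> x" if "x \<in> I" for x using that by (auto simp: closed_def)
  then have "{x \<in> minimals T I. n \<le> x} = {}" and "\<forall>x\<in>I. n \<le> x \<longrightarrow> Suc n \<le> T x"
    by (auto simp: minimals_def)
  then show ?thesis unfolding scan_inv_def by (auto simp del: Collect_empty_eq)
qed

lemma scan_skip:
  assumes "scan_inv F I (Suc i) mn acc" "closed I" "i < n" "i \<notin> I \<or> mn \<le> T i"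
  shows "scan_inv F I i mn acc"
proof -
  have 1: "mn \<le> Suc n" "acc = (\<Sum>x\<in>{x \<in> minimals T I. Suc i \<le> x}. F (sum w I - w x))"
    and 2: "\<And>x. x \<in> I \<Longrightarrow> Suc i \<le> x \<Longrightarrow> mn \<le> T x"
    and 3: "mn = Suc n \<or> (\<exists>x\<in>I. Suc i \<le> x \<and> T x = mn)"
    using assms(1) unfolding scan_inv_def by blast+
  have "i \<notin> minimals T I"
  proof
    assume i: "i \<in> minimals T I"
    then have "mn \<le> T i" using assms(4) by (auto simp: minimals_def)
    then have "mn \<noteq> Suc n" using T_bounds[OF assms(3)] by auto
    with 3 obtain x where x: "x \<in> I" "Suc i \<le> x" "T x = mn" by blast
    have "T x \<noteq> T i" using inj_onD[OF inj_T, of x i] x assms(2,3) by (auto simp: closed_def)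
    with x \<open>mn \<le> T i\<close> have "precedes T x i" by (simp add: precedes_def)
    with i x show False by (auto simp: minimals_def)
  qed
  then have "{x \<in> minimals T I. i \<le> x} = {x \<in> minimals T I. Suc i \<le> x}"
    by (auto simp: Suc_le_eq le_less)
  moreover have "mn \<le> T x" if "x \<in> I" "i \<le> x" for x
    using 2[OF that(1)] that assms(4) by (cases "x = i") auto
  moreover have "mn = Suc n \<or> (\<exists>x\<in>I. i \<le> x \<and> T x = mn)" using 3 Suc_leD by blast
  ultimately show ?thesis using 1 unfolding scan_inv_def by auto
qed

lemma scan_take:
  assumes "scan_inv F I (Suc i) mn acc" "closed I" "i \<in> I" "T i < mn"
  shows "scan_inv F I i (T i) (acc + F (sum w I - w i))"
proof -
  have 1: "mn \<le> Suc n" "acc = (\<Sum>x\<in>{x \<in> minimals T I. Suc i \<le> x}. F (sum w I - w x))"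
    and 2: "\<And>x. x \<in> I \<Longrightarrow> Suc i \<le> x \<Longrightarrow> mn \<le> T x"
    using assms(1) unfolding scan_inv_def by blast+
  have "\<not> precedes T y i" if "y \<in> I" for y
    using 2[OF that] assms(4) by (auto simp: precedes_def)
  then have "i \<in> minimals T I" using assms(3) by (simp add: minimals_def)
  then have "{x \<in> minimals T I. i \<le> x} = insert i {x \<in> minimals T I. Suc i \<le> x}"
    by (auto simp: Suc_le_eq le_less)
  moreover have "finite (minimals T I)" using finite_closed[OF assms(2)] by (simp add: minimals_def)
  ultimately have "acc + F (sum w I - w i) = (\<Sum>x\<in>{x \<in> minimals T I. i \<le> x}. F (sum w I - w x))"
    using 1(2) by simp
  moreover have "T i \<le> T x" if "x \<in> I" "i \<le> x" for x
    using 2[OF that(1)] that assms(4) by (cases "x = i") auto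
  ultimately show ?thesis using 1(1) assms(3,4) unfolding scan_inv_def by auto
qed

lemma scan_sum:
  assumes "closed I" "I \<noteq> {}" "table_inv (sum w I) F"
  shows "(\<Sum>x\<in>minimals T I. F (sum w I - w x)) = card (lin_exts T I)"
  unfolding card_lin_exts[OF finite_closed[OF assms(1)] assms(2)]
  using assms(3) closed_remove[OF assms(1)] unfolding table_inv_def by (intro sum.cong) metis+

lemma card_lin_exts_closed: "closed I \<Longrightarrow> card (lin_exts T I) \<le> fact n"
proof -
  assume I: "closed I"
  then have "card I \<le> n" unfolding closed_def using card_mono[of "{..<n}" I] by simp
  then show ?thesis
    using card_lin_exts_le[OF finite_closed[OF I]] fact_mono le_trans by blast
qed

text \<open>Bounds the intermediate sums too, as \<open>peak\<close> records every number that
  occurs.\<close>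

lemma scan_bound:
  assumes "scan_inv F I i mn acc" "closed I" "I \<noteq> {}" "table_inv (sum w I) F"
  shows "acc \<le> fact n"
proof -
  have "acc \<le> (\<Sum>x\<in>minimals T I. F (sum w I - w x))"
    using assms(1) finite_closed[OF assms(2)] unfolding scan_inv_def
    by (auto intro!: sum_mono2 simp: minimals_def)
  then show ?thesis
    unfolding scan_sum[OF assms(2-4)] using card_lin_exts_closed[OF assms(2)] by simp
qed

text \<open>Since codes are injective, the new entry concerns no closed set other than
  \<open>I\<close>.\<close>

lemma scan_final:
  assumes "scan_inv F I 0 mn acc" "closed I" "I \<noteq> {}" "table_inv (sum w I) F"
  shows "table_inv (Suc (sum w I)) (F(sum w I := acc))"
  unfolding table_inv_def
proof (intro allI impI)
  have acc: "acc = card (lin_exts T I)"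
    using assms(1) scan_sum[OF assms(2-4)] by (simp add: scan_inv_def)
  fix J assume J: "closed J" "sum w J < Suc (sum w I)"
  show "(F(sum w I := acc)) (sum w J) = card (lin_exts T J)"
  proof (cases "sum w J = sum w I")
    case True
    then have "J = I" using code_inj J(1) assms(2) by blast
    then show ?thesis by (simp add: acc)
  next
    case False
    then show ?thesis using J assms(4) by (simp add: table_inv_def)
  qed
qed

end

section \<open>The program\<close>

text \<open>Some registers change their role: \<open>rR\<close> holds the tip while peeling and the
  remainder while decoding, \<open>rP\<close> the number of assigned indices and then the running
  minimum, \<open>rAcc\<close> the next weight and then the sum of table entries. \<open>rM\<close>
  is the code in progress.\<close>

abbreviation (input) "rOut \<equiv> 0 :: nat"
abbreviation (input) "rZero \<equiv> 1 :: nat"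
abbreviation (input) "rN \<equiv> 2 :: nat"
abbreviation (input) "rI \<equiv> 3 :: nat"
abbreviation (input) "rA \<equiv> 4 :: nat"
abbreviation (input) "rT \<equiv> 5 :: nat"
abbreviation (input) "rW \<equiv> 6 :: nat"
abbreviation (input) "rP \<equiv> 7 :: nat"
abbreviation (input) "rC \<equiv> 8 :: nat"
abbreviation (input) "rR \<equiv> 9 :: nat"
abbreviation (input) "rAcc \<equiv> 10 :: nat"
abbreviation (input) "rM \<equiv> 11 :: nat"
abbreviation (input) "rX \<equiv> 12 :: nat"
abbreviation (input) "rOne \<equiv> 13 :: nat"

abbreviation (input) "aVal \<equiv> 0 :: nat"
abbreviation (input) "aWeight \<equiv> 1 :: nat"
abbreviation (input) "aOrd \<equiv> 2 :: nat"
abbreviation (input) "aIn \<equiv> 3 :: nat"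
abbreviation (input) "aTable \<equiv> 4 :: nat"

text \<open>Loops count down, so index \<open>x\<close> stands for position \<open>n - x\<close> of the permutation.\<close>

definition read_body :: com where
  "read_body = Input rA ;; Put aVal rI rA"

text \<open>Truncated subtraction serves as comparison: 1 - w is positive iff w = 0, and the second
  difference is positive iff the value exceeds the tip.\<close>

definition peel_body :: com where
  "peel_body =
     Fetch rA aWeight rI ;; VSub rT rOne rA ;;
     IfPos rT (
       Fetch rA aVal rI ;; VSub rT rA rR ;;
       IfPos rT (
         Put aWeight rI rW ;; VAdd rAcc rAcc rW ;; VAdd rR rA rZero ;;
         Put aOrd rP rI ;; VAdd rP rP rOne))"

definition peel_round :: com where
  "peel_round =
     (VConst rR 0 ;; VAdd rAcc rW rZero ;; VAdd rI rN rZero) ;;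
     Loop rI peel_body ;; VAdd rW rAcc rZero"

text \<open>The added one makes the test positive iff the weight is at most the remainder.\<close>

definition decode_body :: com where
  "decode_body =
     Fetch rX aOrd rI ;; Fetch rA aWeight rX ;; VAdd rT rR rOne ;; VSub rT rT rA ;;
     Put aIn rX rZero ;; IfPos rT (Put aIn rX rOne ;; VSub rR rR rA)"

definition scan_body :: com where
  "scan_body =
     Fetch rT aIn rI ;;
     IfPos rT (
       Fetch rA aVal rI ;; VSub rT rP rA ;;
       IfPos rT (
         VAdd rP rA rZero ;; Fetch rA aWeight rI ;; VSub rT rM rA ;;
         Fetch rA aTable rT ;; VAdd rAcc rAcc rA))"

definition table_body :: com where
  "table_body =
     (VAdd rM rM rOne ;; VAdd rR rM rZero ;; VAdd rI rN rZero) ;;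
     Loop rI decode_body ;;
     (VAdd rP rN rOne ;; VConst rAcc 0 ;; VAdd rI rN rZero) ;;
     Loop rI scan_body ;;
     Put aTable rM rAcc"

text \<open>Entry 0 belongs to the empty set, and \<open>rM\<close> still has its initial value 0
  when the table loop starts. After peeling \<open>rW\<close> is one more than the total weight, so
  \<open>rW - 1\<close> rounds end at the code of the full set. There are always n peeling rounds;
  those after the last chain change nothing in the decomposition.\<close>

definition count_program :: com where
  "count_program =
     (VConst rOne 1 ;; Input rN ;; VAdd rI rN rZero) ;;
     Loop rI read_body ;;
     (VConst rW 1 ;; VAdd rC rN rZero) ;;
     Loop rC peel_round ;;
     (Put aTable rZero rOne ;; VSub rC rW rOne) ;;
     Loop rC table_body ;;
     Fetch rOut aTable rM"

lemma wf_count_program: "wf_com count_program"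
  by (simp add: count_program_def table_body_def scan_body_def decode_body_def peel_round_def
      peel_body_def read_body_def)

section \<open>Hoare triples with bounds on time and on the size of numbers\<close>

definition hoare :: "nat \<Rightarrow> (state \<Rightarrow> bool) \<Rightarrow> com \<Rightarrow> nat \<Rightarrow> (state \<Rightarrow> bool) \<Rightarrow> bool" where
  "hoare B P c t Q \<longleftrightarrow> (\<forall>s. P s \<longrightarrow> peak s \<le> B \<longrightarrow>
     Q (exec c s) \<and> clock (exec c s) \<le> clock s + t \<and> peak (exec c s) \<le> B)"

lemma hoareI:
  assumes "\<And>s. P s \<Longrightarrow> peak s \<le> B \<Longrightarrow>
    Q (exec c s) \<and> clock (exec c s) \<le> clock s + t \<and> peak (exec c s) \<le> B"
  shows "hoare B P c t Q"
  using assms by (simp add: hoare_def)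

lemma hoare_Seq:
  assumes "hoare B P c t Q" "hoare B Q d u R"
  shows "hoare B P (c ;; d) (t + u) R"
proof (rule hoareI)
  fix s assume "P s" "peak s \<le> B"
  with assms(1) have 1: "Q (exec c s)" "clock (exec c s) \<le> clock s + t" "peak (exec c s) \<le> B"
    by (auto simp: hoare_def)
  with assms(2) have "R (exec d (exec c s))" "clock (exec d (exec c s)) \<le> clock (exec c s) + u"
    "peak (exec d (exec c s)) \<le> B"
    by (auto simp: hoare_def)
  with 1(2) show "R (exec (c ;; d) s) \<and> clock (exec (c ;; d) s) \<le> clock s + (t + u) \<and>
      peak (exec (c ;; d) s) \<le> B"
    by simp
qed

lemma hoare_weaken:
  assumes "hoare B P c t Q" "\<And>s. P' s \<Longrightarrow> P s" "\<And>s. Q s \<Longrightarrow> Q' s" "t \<le> t'"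
  shows "hoare B P' c t' Q'"
  using assms unfolding hoare_def by (meson add_le_mono le_refl le_trans)

text \<open>The constants 6 and 3 are the ticks of a round and of the exit. Stability says that the
  invariant ignores the counter and the ghost components.\<close>

lemma hoare_Loop:
  assumes body: "\<And>k. k < m \<Longrightarrow> hoare B (\<lambda>s. Inv (Suc k) s \<and> var s x = k) c t (Inv k)"
    and stable: "\<And>k j u b s. Inv k s \<Longrightarrow> Inv k (tick u b (setv x j s))"
      "\<And>u b s. Inv 0 s \<Longrightarrow> Inv 0 (tick u b s)"
    and B: "1 \<le> B"
  shows "hoare B (\<lambda>s. Inv m s \<and> var s x = m) (Loop x c) (m * (t + 6) + 3) (Inv 0)"
proof (rule hoareI)
  fix s assume s: "Inv m s \<and> var s x = m" "peak s \<le> B"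
  define P where "P k s' \<longleftrightarrow> Inv k s' \<and> clock s' + k * (t + 6) \<le> clock s + m * (t + 6) \<and> peak s' \<le> B"
    for k s'
  show "Inv 0 (exec (Loop x c) s) \<and> clock (exec (Loop x c) s) \<le> clock s + (m * (t + 6) + 3) \<and>
      peak (exec (Loop x c) s) \<le> B"
  proof (rule Loop_invariant[where P = P])
    show "P (var s x) s" using s by (simp add: P_def)
    show "P k (exec c (iter x k s'))" if "k < var s x" "P (Suc k) s'" for k s'
    proof -
      have "Inv (Suc k) (iter x k s')" "var (iter x k s') x = k" "peak (iter x k s') \<le> B"
        using that stable(1) B by (simp_all add: P_def iter_def)
      with body[of k] that(1) s(1) have "Inv k (exec c (iter x k s'))"
        "clock (exec c (iter x k s')) \<le> clock (iter x k s') + t" "peak (exec c (iter x k s')) \<le> B"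
        unfolding hoare_def by auto
      with that(2) show ?thesis by (simp add: P_def iter_def)
    qed
    show "Inv 0 (tick 3 1 s') \<and> clock (tick 3 1 s') \<le> clock s + (m * (t + 6) + 3) \<and>
        peak (tick 3 1 s') \<le> B" if "P 0 s'" for s'
      using that stable(2)[where s = s' and u = 3 and b = 1] B by (simp add: P_def)
  qed
qed

text \<open>Weights and codes are at most \<open>2 ^ n\<close> and addresses about eight times that;
  table entries and partial sums are at most \<open>fact n\<close>; the rest absorbs small
  constants.\<close>

definition peak_bound :: "nat \<Rightarrow> nat" where
  "peak_bound n = 16 * 2 ^ n + fact n + 40"

lemma peak_bounds: "a \<le> n \<Longrightarrow> 8 * a + 30 \<le> peak_bound n" "a \<le> 2 ^ n \<Longrightarrow> 8 * a + 30 \<le> peak_bound n"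
  "a \<le> fact n \<Longrightarrow> a \<le> peak_bound n"
proof -
  have "n < 2 ^ n" by (rule less_exp)
  then show "8 * a + 30 \<le> peak_bound n" if "a \<le> n"
    using that unfolding peak_bound_def by linarith
qed (simp_all add: peak_bound_def)

section \<open>Verification of the peeling phase\<close>

definition base :: "nat \<Rightarrow> (nat \<Rightarrow> nat) \<Rightarrow> state \<Rightarrow> bool" where
  "base n T s \<longleftrightarrow> var s rN = n \<and> var s rOne = 1 \<and> var s rZero = 0 \<and> (\<forall>x<n. arr s aVal x = T x)"

text \<open>The bound by a power of 2 limits the weights for every permutation: an assignment raises
  \<open>rP\<close> by one and adds \<open>W\<close>, which is at most \<open>rAcc\<close>, so it at
  most doubles \<open>rAcc\<close>.\<close>

definition peel_state :: "nat \<Rightarrow> (nat \<Rightarrow> nat) \<Rightarrow> nat \<Rightarrow> nat \<Rightarrow> nat \<Rightarrow> state \<Rightarrow> bool" where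
  "peel_state n T p\<^sub>0 W k s \<longleftrightarrow> base n T s \<and> var s rW = W \<and> var s rM = 0 \<and>
     var s rAcc \<le> 2 ^ var s rP \<and>
     peeling n T p\<^sub>0 W (arr s aWeight) (var s rAcc) (var s rR) (var s rP) (arr s aOrd) k"

lemma hoare_peel_body:
  assumes T: "inj_on T {..<n}" "\<And>x. x < n \<Longrightarrow> 0 < T x \<and> T x \<le> n" and k: "k < n"
  shows "hoare (peak_bound n) (\<lambda>s. peel_state n T p\<^sub>0 W (Suc k) s \<and> var s rI = k) peel_body 41
           (peel_state n T p\<^sub>0 W k)"
proof (rule hoareI, elim conjE)
  fix s assume s: "peel_state n T p\<^sub>0 W (Suc k) s" "var s rI = k" and pk: "peak s \<le> peak_bound n"
  then have b: "base n T s" "var s rW = W" "var s rM = 0" "var s rAcc \<le> 2 ^ var s rP"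
    and inv: "peeling n T p\<^sub>0 W (arr s aWeight) (var s rAcc) (var s rR) (var s rP) (arr s aOrd) (Suc k)"
    by (auto simp: peel_state_def)
  have b': "var s rN = n" "var s rOne = 1" "var s rZero = 0" "arr s aVal k = T k"
    using b(1) k by (auto simp: base_def)
  let ?assign = "arr s aWeight k = 0 \<and> var s rR < T k"
  consider (assign) "?assign" | (skip) "0 < arr s aWeight k \<or> T k \<le> var s rR" by linarith
  then show "peel_state n T p\<^sub>0 W k (exec peel_body s) \<and>
      clock (exec peel_body s) \<le> clock s + 41 \<and> peak (exec peel_body s) \<le> peak_bound n"
  proof cases
    case assign
    note step = peeling_assign[OF inv k assign[THEN conjunct1] assign[THEN conjunct2]]
    have Wacc: "W \<le> var s rAcc" using peeling.W_le_acc[OF inv] .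
    have p: "Suc (var s rP) \<le> n" using peeling.p_le[OF step] .
    have acc: "var s rAcc + W \<le> 2 ^ Suc (var s rP)" using Wacc b(4) by simp
    also have "\<dots> \<le> 2 ^ n" using p by (intro power_increasing) auto
    finally have acc': "var s rAcc + W \<le> 2 ^ n" .
    show ?thesis
      using assign b b' s(2) pk step acc peak_bounds(1)[of k n] peak_bounds(1)[of "var s rP" n]
        peak_bounds(1)[of "Suc (var s rP)" n] peak_bounds(1)[of "T k" n]
        peak_bounds(2)[OF acc'] p k T(2)[OF k]
      by (simp add: peel_body_def peel_state_def base_def)
  next
    case skip
    note step = peeling_skip[OF inv T(1) T(2)[OF k, THEN conjunct1] k skip]
    show ?thesis
    proof (cases "arr s aWeight k = 0")
      case True
      with skip have "T k \<le> var s rR" by simp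
      with True show ?thesis
        using b b' s(2) pk step peak_bounds(1)[of k n] k
        by (simp add: peel_body_def peel_state_def base_def)
    next
      case False
      then show ?thesis
        using b b' s(2) pk step peak_bounds(1)[of k n] k
        by (simp add: peel_body_def peel_state_def base_def)
    qed
  qed
qed


lemma peel_state_stable:
  "peel_state n T p\<^sub>0 W k s \<Longrightarrow> peel_state n T p\<^sub>0 W k (tick u b (setv rI j s))"
  "peel_state n T p\<^sub>0 W k s \<Longrightarrow> peel_state n T p\<^sub>0 W k (tick u b s)"
  by (simp_all add: peel_state_def base_def)

text \<open>The last clause expresses that at least one index is assigned per round until all are,
  so n rounds suffice.\<close>

definition round_state :: "nat \<Rightarrow> (nat \<Rightarrow> nat) \<Rightarrow> nat \<Rightarrow> state \<Rightarrow> bool" where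
  "round_state n T k s \<longleftrightarrow> base n T s \<and> var s rM = 0 \<and> var s rW \<le> 2 ^ var s rP \<and>
     peeling n T (var s rP) (var s rW) (arr s aWeight) (var s rW) 0 (var s rP) (arr s aOrd) n \<and>
     (\<forall>x. arr s aWeight x < var s rW) \<and> n \<le> var s rP + k"

lemma round_state_stable:
  "round_state n T k s \<Longrightarrow> round_state n T k (tick u b (setv rC j s))"
  "round_state n T k s \<Longrightarrow> round_state n T k (tick u b s)"
  by (simp_all add: round_state_def base_def)

lemma peeling_acc_le:
  assumes "peeling n T p\<^sub>0 W w acc tip p ord i" "acc \<le> 2 ^ p"
  shows "acc \<le> 2 ^ n"
  using assms(2) power_increasing[OF peeling.p_le[OF assms(1)], of "2 :: nat"] by linarith

lemma hoare_peel_round: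
  assumes T: "inj_on T {..<n}" "\<And>x. x < n \<Longrightarrow> 0 < T x \<and> T x \<le> n" and k: "k < n"
  shows "hoare (peak_bound n) (\<lambda>s. round_state n T (Suc k) s \<and> var s rC = k) peel_round (47 * n + 7)
           (round_state n T k)"
proof -
  have 1: "1 \<le> peak_bound n" by (simp add: peak_bound_def)
  show ?thesis
  proof (rule hoareI, elim conjE)
    fix s assume s: "round_state n T (Suc k) s" "var s rC = k" "peak s \<le> peak_bound n"
    define p\<^sub>0 W where "p\<^sub>0 = var s rP" and "W = var s rW"
    have inv: "peeling n T p\<^sub>0 W (arr s aWeight) W 0 p\<^sub>0 (arr s aOrd) n"
      and b: "base n T s" "var s rM = 0" "W \<le> 2 ^ p\<^sub>0" and p0: "n \<le> p\<^sub>0 + Suc k"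
      using s(1) by (auto simp: round_state_def p\<^sub>0_def W_def)
    have W: "W \<le> 2 ^ n" by (rule peeling_acc_le[OF inv b(3)])
    have "hoare (peak_bound n) (\<lambda>s'. s' = s) (VConst rR 0 ;; VAdd rAcc rW rZero ;; VAdd rI rN rZero)
        3 (\<lambda>s. peel_state n T p\<^sub>0 W n s \<and> var s rI = n)"
      using b inv s(3) W peak_bounds(2)[OF W] peak_bounds(1)[of n n]
      by (intro hoareI) (simp add: peel_state_def base_def p\<^sub>0_def W_def)
    moreover have "hoare (peak_bound n) (\<lambda>s. peel_state n T p\<^sub>0 W n s \<and> var s rI = n)
        (Loop rI peel_body) (n * (41 + 6) + 3) (peel_state n T p\<^sub>0 W 0)"
      by (rule hoare_Loop[OF hoare_peel_body[OF T] peel_state_stable 1])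
    moreover have "hoare (peak_bound n) (peel_state n T p\<^sub>0 W 0) (VAdd rW rAcc rZero) 1
        (round_state n T k)"
    proof (rule hoareI)
      fix s assume s: "peel_state n T p\<^sub>0 W 0 s" "peak s \<le> peak_bound n"
      then have b: "base n T s" "var s rW = W" "var s rM = 0" "var s rAcc \<le> 2 ^ var s rP"
        and inv: "peeling n T p\<^sub>0 W (arr s aWeight) (var s rAcc) (var s rR) (var s rP) (arr s aOrd) 0"
        by (auto simp: peel_state_def)
      \<comment> \<open>An index still unassigned was skipped because of some element of the new
        chain; so this chain is nonempty and \<open>rP\<close> has grown.\<close>
      have "n \<le> var s rP + k"
      proof (cases "var s rP < n")
        case True
        from peeling.ex_unassigned[OF inv this] obtain x where x: "x < n" "arr s aWeight x = 0"
          by blast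
        from peeling.skipped[OF inv _ this] peeling.progress(2)[OF inv] have "p\<^sub>0 < var s rP" by blast
        with p0 show ?thesis by simp
      qed simp
      with s(2) b peeling_round[OF inv] peak_bounds(2)[OF peeling_acc_le[OF inv b(4)]]
      show "round_state n T k (exec (VAdd rW rAcc rZero) s) \<and>
          clock (exec (VAdd rW rAcc rZero) s) \<le> clock s + 1 \<and>
          peak (exec (VAdd rW rAcc rZero) s) \<le> peak_bound n"
        by (simp add: round_state_def base_def)
    qed
    ultimately have "hoare (peak_bound n) (\<lambda>s'. s' = s) peel_round
        (3 + (n * (41 + 6) + 3 + 1)) (round_state n T k)"
      unfolding peel_round_def by (intro hoare_Seq)
    with s(3) show "round_state n T k (exec peel_round s) \<and>
        clock (exec peel_round s) \<le> clock s + (47 * n + 7) \<and> peak (exec peel_round s) \<le> peak_bound n"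
      by (simp add: hoare_def)
  qed
qed

section \<open>Verification of the table phase\<close>

context coding
begin

definition "total_weight = (\<Sum>x<n. w x)"

definition table_state :: "nat \<Rightarrow> (nat \<Rightarrow> nat) \<Rightarrow> state \<Rightarrow> bool" where
  "table_state m F s \<longleftrightarrow> base n T s \<and> arr s aWeight = w \<and> arr s aOrd = ord \<and>
     var s rM = m \<and> arr s aTable = F"

definition decode_state :: "nat \<Rightarrow> (nat \<Rightarrow> nat) \<Rightarrow> nat \<Rightarrow> state \<Rightarrow> bool" where
  "decode_state m F k s \<longleftrightarrow> table_state m F s \<and> (\<exists>J. decode_inv m k (var s rR) J \<and>
     (\<forall>q. k \<le> q \<longrightarrow> q < n \<longrightarrow> arr s aIn (ord q) = (if ord q \<in> J then 1 else 0)))"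

definition scan_state :: "nat set \<Rightarrow> (nat \<Rightarrow> nat) \<Rightarrow> nat \<Rightarrow> state \<Rightarrow> bool" where
  "scan_state I F k s \<longleftrightarrow> table_state (sum w I) F s \<and> scan_inv F I k (var s rP) (var s rAcc) \<and>
     (\<forall>x<n. arr s aIn x = (if x \<in> I then 1 else 0))"

lemma state_stable:
  "decode_state m F k s \<Longrightarrow> decode_state m F k (tick u b (setv rI j s))"
  "decode_state m F k s \<Longrightarrow> decode_state m F k (tick u b s)"
  "scan_state I F k s \<Longrightarrow> scan_state I F k (tick u b (setv rI j s))"
  "scan_state I F k s \<Longrightarrow> scan_state I F k (tick u b s)"
  by (simp_all add: decode_state_def scan_state_def table_state_def base_def)

lemma ord_less: "q < n \<Longrightarrow> ord q < n"
  using bij_ord by (auto simp: bij_betw_def)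

lemma hoare_decode_body:
  assumes k: "k < n" and m: "m \<le> 2 ^ n"
  shows "hoare (peak_bound n) (\<lambda>s. decode_state m F (Suc k) s \<and> var s rI = k) decode_body 30
           (decode_state m F k)"
proof (rule hoareI, elim conjE)
  fix s assume s: "decode_state m F (Suc k) s" "var s rI = k" "peak s \<le> peak_bound n"
  then obtain J where J: "decode_inv m (Suc k) (var s rR) J"
    "\<And>q. Suc k \<le> q \<Longrightarrow> q < n \<Longrightarrow> arr s aIn (ord q) = (if ord q \<in> J then 1 else 0)"
    and t: "table_state m F s"
    by (auto simp: decode_state_def)
  have t': "var s rN = n" "var s rOne = 1" "var s rZero = 0" "arr s aOrd k = ord k"
    "arr s aWeight = w" "arr s aOrd = ord"
    using t by (auto simp: base_def table_state_def)
  have notin: "ord k \<notin> J"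
  proof
    assume "ord k \<in> J"
    then obtain q where "ord k = ord q" "Suc k \<le> q" "q < n"
      using J(1) by (auto simp: decode_inv_def)
    with ord_inj[of k q] k show False by simp
  qed
  have ne: "ord q \<noteq> ord k" if "Suc k \<le> q" "q < n" for q
    using ord_inj[of q k] that k by auto
  have "var s rR \<le> m" using J(1) by (auto simp: decode_inv_def)
  with m have R: "var s rR \<le> 2 ^ n" by simp
  note bounds = peak_bounds(1)[of k n] peak_bounds(1)[of "ord k" n] peak_bounds(2)[OF R]
  show "decode_state m F k (exec decode_body s) \<and> clock (exec decode_body s) \<le> clock s + 30 \<and>
      peak (exec decode_body s) \<le> peak_bound n"
  proof (cases "w (ord k) \<le> var s rR")
    case True
    let ?J = "insert (ord k) J"
    have "arr (exec decode_body s) aIn = (arr s aIn)(ord k := 1)"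
      "var (exec decode_body s) rR = var s rR - w (ord k)"
      "table_state m F (exec decode_body s)"
      using True t t' s(2) by (auto simp: decode_body_def table_state_def base_def)
    moreover have "((arr s aIn)(ord k := 1)) (ord q) = (if ord q \<in> ?J then 1 else 0)"
      if "k \<le> q" "q < n" for q
      using J(2)[of q] ne[of q] that by (cases "q = k") auto
    ultimately have "decode_state m F k (exec decode_body s)"
      unfolding decode_state_def using decode_take[OF J(1) k True] by (intro conjI exI[of _ ?J]) auto
    moreover have "clock (exec decode_body s) \<le> clock s + 30 \<and> peak (exec decode_body s) \<le> peak_bound n"
      using True t' s(2,3) bounds k ord_less[OF k] by (simp add: decode_body_def)
    ultimately show ?thesis by blast
  next
    case False
    have "arr (exec decode_body s) aIn = (arr s aIn)(ord k := 0)"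
      "var (exec decode_body s) rR = var s rR"
      "table_state m F (exec decode_body s)"
      using False t t' s(2) by (auto simp: decode_body_def table_state_def base_def)
    moreover have "((arr s aIn)(ord k := 0)) (ord q) = (if ord q \<in> J then 1 else 0)"
      if "k \<le> q" "q < n" for q
      using J(2)[of q] ne[of q] that notin by (cases "q = k") auto
    ultimately have "decode_state m F k (exec decode_body s)"
      unfolding decode_state_def using decode_skip[OF J(1) k] False
      by (intro conjI exI[of _ J]) auto
    moreover have "clock (exec decode_body s) \<le> clock s + 30 \<and> peak (exec decode_body s) \<le> peak_bound n"
      using False t' s(2,3) bounds k ord_less[OF k] by (simp add: decode_body_def)
    ultimately show ?thesis by blast
  qed
qed

lemma hoare_scan_body:
  assumes k: "k < n" and I: "closed I" "I \<noteq> {}" and F: "table_inv (sum w I) F"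
    and m: "sum w I \<le> 2 ^ n"
  shows "hoare (peak_bound n) (\<lambda>s. scan_state I F (Suc k) s \<and> var s rI = k) scan_body 35
           (scan_state I F k)"
proof (rule hoareI, elim conjE)
  fix s assume s: "scan_state I F (Suc k) s" "var s rI = k" "peak s \<le> peak_bound n"
  then have t: "table_state (sum w I) F s"
    and inv: "scan_inv F I (Suc k) (var s rP) (var s rAcc)"
    and mem: "\<And>x. x < n \<Longrightarrow> arr s aIn x = (if x \<in> I then 1 else 0)"
    by (auto simp: scan_state_def)
  have t': "var s rN = n" "var s rOne = 1" "var s rZero = 0" "arr s aVal k = T k"
    "arr s aWeight = w" "arr s aTable = F" "var s rM = sum w I"
    using t k by (auto simp: base_def table_state_def)
  have "sum w I - w k \<le> 2 ^ n" using m by simp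
  note bounds = peak_bounds(1)[of k n] peak_bounds(2)[OF this] peak_bounds(1)[of "T k" n]
    T_bounds[OF k]
  consider (out) "k \<notin> I" | (skip) "k \<in> I" "var s rP \<le> T k" | (take) "k \<in> I" "T k < var s rP"
    by linarith
  then show "scan_state I F k (exec scan_body s) \<and> clock (exec scan_body s) \<le> clock s + 35 \<and>
      peak (exec scan_body s) \<le> peak_bound n"
  proof cases
    case out
    then show ?thesis
      using t t' s(2,3) bounds k mem scan_skip[OF inv I(1) k]
      by (simp add: scan_body_def scan_state_def table_state_def base_def)
  next
    case skip
    then show ?thesis
      using t t' s(2,3) bounds k mem scan_skip[OF inv I(1) k]
      by (simp add: scan_body_def scan_state_def table_state_def base_def)
  next
    case take
    note step = scan_take[OF inv I(1) take]
    from take show ?thesis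
      using t t' s(2,3) bounds k mem step peak_bounds(3)[OF scan_bound[OF step I F]]
      by (simp add: scan_body_def scan_state_def table_state_def base_def)
  qed
qed

end

context coding
begin

text \<open>The counter falls while the table grows, so with \<open>k\<close> rounds left the
  entries up to \<open>total_weight - k\<close> are correct.\<close>

lemma hoare_table_body:
  assumes m: "total_weight \<le> 2 ^ n" and k: "k < total_weight"
  shows "hoare (peak_bound n)
           (\<lambda>s. (\<exists>F. table_state (total_weight - Suc k) F s \<and> table_inv (Suc (total_weight - Suc k)) F) \<and>
             var s rC = k)
           table_body (83 * n + 18)
           (\<lambda>s. \<exists>F. table_state (total_weight - k) F s \<and> table_inv (Suc (total_weight - k)) F)"
proof (rule hoareI, elim conjE exE)
  fix s F
  define M where "M = total_weight - k"
  assume s: "table_state (total_weight - Suc k) F s" "table_inv (Suc (total_weight - Suc k)) F"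
    "var s rC = k" "peak s \<le> peak_bound n"
  have M: "Suc (total_weight - Suc k) = M" "0 < M" "M \<le> total_weight" using k by (auto simp: M_def)
  with m have M2: "M \<le> 2 ^ n" by simp
  have B: "1 \<le> peak_bound n" by (simp add: peak_bound_def)
  have F: "table_inv M F" using s(2) M(1) by simp
  let ?A = "VAdd rM rM rOne ;; VAdd rR rM rZero ;; VAdd rI rN rZero"
  let ?B = "VAdd rP rN rOne ;; VConst rAcc 0 ;; VAdd rI rN rZero"
  have 1: "hoare (peak_bound n) (\<lambda>s'. s' = s) ?A 3 (\<lambda>s. decode_state M F n s \<and> var s rI = n)"
  proof (rule hoareI)
    fix s' assume "s' = s" "peak s' \<le> peak_bound n"
    moreover have "var s rM + 1 = M" using s(1) M(1) by (simp add: table_state_def)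
    ultimately show "(decode_state M F n (exec ?A s') \<and> var (exec ?A s') rI = n) \<and>
        clock (exec ?A s') \<le> clock s' + 3 \<and> peak (exec ?A s') \<le> peak_bound n"
      using s(1) decode_init[of M] M(3) peak_bounds(2)[OF M2] peak_bounds(1)[of n n]
      by (auto simp: decode_state_def table_state_def base_def total_weight_def)
  qed
  have 2: "hoare (peak_bound n) (\<lambda>s. decode_state M F n s \<and> var s rI = n)
      (Loop rI decode_body) (n * (30 + 6) + 3) (decode_state M F 0)"
    by (rule hoare_Loop[OF hoare_decode_body[OF _ M2] state_stable(1,2) B])
  have 3: "hoare (peak_bound n) (decode_state M F 0) (?B ;; Loop rI scan_body ;; Put aTable rM rAcc)
      (3 + (n * (35 + 6) + 3 + 6)) (\<lambda>s. \<exists>F. table_state M F s \<and> table_inv (Suc M) F)"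
  proof (rule hoareI)
    fix s assume s: "decode_state M F 0 s" "peak s \<le> peak_bound n"
    then obtain I where J: "decode_inv M 0 (var s rR) I"
      "\<And>q. q < n \<Longrightarrow> arr s aIn (ord q) = (if ord q \<in> I then 1 else 0)"
      and t: "table_state M F s"
      by (auto simp: decode_state_def)
    note I = decode_final[OF J(1)]
    \<comment> \<open>The recursion fails for the empty set, but its code 0 was entered
      beforehand.\<close>
    have "I \<noteq> {}" using I(2) M(2) by auto
    have mem: "arr s aIn x = (if x \<in> I then 1 else 0)" if "x < n" for x
    proof -
      have "x \<in> ord ` {..<n}" using bij_ord that by (auto simp: bij_betw_def)
      then show ?thesis using J(2) by auto
    qed
    have a: "hoare (peak_bound n) (\<lambda>s'. s' = s) ?B 3 (\<lambda>s. scan_state I F n s \<and> var s rI = n)"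
      using s(2) t mem I(2) scan_init[OF I(1), of F] peak_bounds(1)[of n n]
      by (intro hoareI) (auto simp: scan_state_def table_state_def base_def)
    have b: "hoare (peak_bound n) (\<lambda>s. scan_state I F n s \<and> var s rI = n)
        (Loop rI scan_body) (n * (35 + 6) + 3) (scan_state I F 0)"
      using hoare_scan_body[OF _ I(1) \<open>I \<noteq> {}\<close>, of _ F] F M2 I(2)
      by (intro hoare_Loop state_stable(3,4) B) auto
    have c: "hoare (peak_bound n) (scan_state I F 0) (Put aTable rM rAcc) 6
        (\<lambda>s. \<exists>F. table_state M F s \<and> table_inv (Suc M) F)"
    proof (rule hoareI)
      fix s assume s: "scan_state I F 0 s" "peak s \<le> peak_bound n"
      then have t: "table_state M F s" and inv: "scan_inv F I 0 (var s rP) (var s rAcc)"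
        by (auto simp: scan_state_def I(2))
      have "table_inv (Suc M) (F(M := var s rAcc))"
        using scan_final[OF inv I(1) \<open>I \<noteq> {}\<close>] F I(2) by simp
      moreover have "table_state M (F(M := var s rAcc)) (exec (Put aTable rM rAcc) s)"
        using t by (simp add: table_state_def base_def)
      ultimately show "(\<exists>F. table_state M F (exec (Put aTable rM rAcc) s) \<and> table_inv (Suc M) F) \<and>
          clock (exec (Put aTable rM rAcc) s) \<le> clock s + 6 \<and>
          peak (exec (Put aTable rM rAcc) s) \<le> peak_bound n"
        using s(2) t peak_bounds(2)[OF M2] by (auto simp: table_state_def)
    qed
    from hoare_Seq[OF a hoare_Seq[OF b c]] s(2)
    show "(\<exists>F. table_state M F (exec (?B ;; Loop rI scan_body ;; Put aTable rM rAcc) s) \<and>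
          table_inv (Suc M) F) \<and>
        clock (exec (?B ;; Loop rI scan_body ;; Put aTable rM rAcc) s)
          \<le> clock s + (3 + (n * (35 + 6) + 3 + 6)) \<and>
        peak (exec (?B ;; Loop rI scan_body ;; Put aTable rM rAcc) s) \<le> peak_bound n"
      by (simp only: hoare_def)
  qed
  have "hoare (peak_bound n) (\<lambda>s'. s' = s) table_body
      (3 + (n * (30 + 6) + 3 + (3 + (n * (35 + 6) + 3 + 6))))
      (\<lambda>s. \<exists>F. table_state M F s \<and> table_inv (Suc M) F)"
    unfolding table_body_def by (rule hoare_Seq[OF 1 hoare_Seq[OF 2 3]])
  with s(4) show "(\<exists>F. table_state M F (exec table_body s) \<and> table_inv (Suc M) F) \<and>
      clock (exec table_body s) \<le> clock s + (83 * n + 18) \<and> peak (exec table_body s) \<le> peak_bound n"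
    unfolding hoare_def by (simp add: algebra_simps)
qed

lemma hoare_table:
  assumes m: "total_weight \<le> 2 ^ n"
  shows "hoare (peak_bound n) (\<lambda>s. table_state 0 F s \<and> table_inv 1 F \<and> var s rC = total_weight)
           (Loop rC table_body ;; Fetch rOut aTable rM) (total_weight * (83 * n + 24) + 9)
           (\<lambda>s. var s rOut = card (lin_exts T {..<n}))"
proof -
  have B: "1 \<le> peak_bound n" by (simp add: peak_bound_def)
  define Inv where "Inv = (\<lambda>k s.
    \<exists>F. table_state (total_weight - k) F s \<and> table_inv (Suc (total_weight - k)) F)"
  have stable: "Inv k s \<Longrightarrow> Inv k (tick u b (setv rC j s))" "Inv k s \<Longrightarrow> Inv k (tick u b s)"
    for k u b j and s :: state
    by (simp_all add: Inv_def table_state_def base_def)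
  have loop: "hoare (peak_bound n) (\<lambda>s. Inv total_weight s \<and> var s rC = total_weight)
      (Loop rC table_body) (total_weight * (83 * n + 18 + 6) + 3) (Inv 0)"
    by (rule hoare_Loop[where Inv = Inv, OF _ stable B]) (simp add: Inv_def hoare_table_body[OF m])
  have "hoare (peak_bound n) (Inv 0) (Fetch rOut aTable rM) 6
      (\<lambda>s. var s rOut = card (lin_exts T {..<n}))"
  proof (rule hoareI)
    fix s assume s: "Inv 0 s" "peak s \<le> peak_bound n"
    then obtain F where F: "table_state total_weight F s" "table_inv (Suc total_weight) F"
      by (auto simp: Inv_def)
    then have "F total_weight = card (lin_exts T {..<n})"
      using closed_all by (auto simp: table_inv_def total_weight_def)
    with F s(2) peak_bounds(2)[OF m]
    show "var (exec (Fetch rOut aTable rM) s) rOut = card (lin_exts T {..<n}) \<and>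
        clock (exec (Fetch rOut aTable rM) s) \<le> clock s + 6 \<and>
        peak (exec (Fetch rOut aTable rM) s) \<le> peak_bound n"
      by (simp add: table_state_def)
  qed
  from hoare_Seq[OF loop this] show ?thesis
    by (rule hoare_weaken) (auto simp: Inv_def)
qed

end

section \<open>Input and the complete program\<close>

lemma hoare_read:
  assumes \<sigma>: "\<sigma> permutes {1..n}"
  shows "hoare (peak_bound n) (\<lambda>s. s = start (perm_input n \<sigma>))
     ((VConst rOne 1 ;; Input rN ;; VAdd rI rN rZero) ;; Loop rI read_body) (13 * n + 6)
     (\<lambda>s. base n (\<lambda>x. \<sigma> (n - x)) s \<and> var s rM = 0 \<and> var s rP = 0 \<and> arr s aWeight = (\<lambda>_. 0))"
proof -
  define Inv where "Inv k s \<longleftrightarrow> var s rN = n \<and> var s rOne = 1 \<and> var s rZero = 0 \<and>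
    var s rM = 0 \<and> var s rP = 0 \<and> arr s aWeight = (\<lambda>_. 0) \<and>
    inp s = map \<sigma> [n + 1 - k..<n + 1] \<and> (\<forall>x. k \<le> x \<longrightarrow> x < n \<longrightarrow> arr s aVal x = \<sigma> (n - x))" for k and s :: state
  have stable: "Inv k s \<Longrightarrow> Inv k (tick u b (setv rI j s))" "Inv k s \<Longrightarrow> Inv k (tick u b s)"
    for k u b j and s :: state
    by (simp_all add: Inv_def)
  have B: "1 \<le> peak_bound n" by (simp add: peak_bound_def)
  have init: "hoare (peak_bound n) (\<lambda>s. s = start (perm_input n \<sigma>))
     (VConst rOne 1 ;; Input rN ;; VAdd rI rN rZero) 3 (\<lambda>s. Inv n s \<and> var s rI = n)"
    using peak_bounds(1)[of n n] B
    by (intro hoareI) (simp add: Inv_def start_def perm_input_def)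
  have body: "hoare (peak_bound n) (\<lambda>s. Inv (Suc k) s \<and> var s rI = k) read_body 7 (Inv k)"
    if k: "k < n" for k
  proof (rule hoareI, elim conjE)
    fix s assume s: "Inv (Suc k) s" "var s rI = k" "peak s \<le> peak_bound n"
    have upt: "[n - k..<n + 1] = (n - k) # [n + 1 - k..<n + 1]"
    proof -
      have "Suc (n - k) = n + 1 - k" using k by simp
      with upt_conv_Cons[of "n - k" "n + 1"] show ?thesis by (metis diff_le_self le_imp_less_Suc Suc_eq_plus1)
    qed
    have inp: "inp s = \<sigma> (n - k) # map \<sigma> [n + 1 - k..<n + 1]"
    proof -
      have "n + 1 - Suc k = n - k" by simp
      moreover have "inp s = map \<sigma> [n + 1 - Suc k..<n + 1]" using s(1) by (simp only: Inv_def)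
      ultimately show ?thesis by (simp only: upt list.map)
    qed
    have "n - k \<in> {1..n}" using k by auto
    then have "\<sigma> (n - k) \<le> n" using permutes_in_image[OF \<sigma>, of "n - k"] by simp
    moreover have "Inv k (exec read_body s)"
    proof -
      define l where "l = map \<sigma> [n + 1 - k..<n + 1]"
      have l: "inp s = \<sigma> (n - k) # l" using inp by (simp only: l_def)
      have b: "var s rN = n" "var s rOne = 1" "var s rZero = 0" "var s rM = 0" "var s rP = 0"
        "arr s aWeight = (\<lambda>_. 0)" "\<And>x. Suc k \<le> x \<Longrightarrow> x < n \<Longrightarrow> arr s aVal x = \<sigma> (n - x)"
        using s(1) unfolding Inv_def by blast+
      have "arr (exec read_body s) aVal x = \<sigma> (n - x)" if "k \<le> x" "x < n" for x
        using b(7) s(2) l that by (cases "x = k") (simp_all add: read_body_def)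
      moreover have "inp (exec read_body s) = l" by (simp add: read_body_def l)
      ultimately show ?thesis unfolding Inv_def l_def using b(1-6) l by (simp add: read_body_def)
    qed
    ultimately show "Inv k (exec read_body s) \<and> clock (exec read_body s) \<le> clock s + 7 \<and>
        peak (exec read_body s) \<le> peak_bound n"
      using s(2,3) inp k peak_bounds(1)[of k n] peak_bounds(1)[of "\<sigma> (n - k)" n]
      by (simp add: read_body_def)
  qed
  from hoare_Seq[OF init hoare_Loop[where Inv = Inv, OF body stable B]] show ?thesis
    by (rule hoare_weaken) (auto simp: Inv_def base_def)
qed

text \<open>No assumption on the number of chains: it affects only the sum of weights in the time
  bound.\<close>

theorem count_program_correct:
  assumes \<sigma>: "\<sigma> permutes {1..n}"
  defines "T \<equiv> \<lambda>x. \<sigma> (n - x)"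
  shows "\<exists>w ord. coding n T w ord \<and>
    (let s = exec count_program (start (perm_input n \<sigma>)) in
      var s 0 = card (weak_interval n \<sigma>) \<and> peak s \<le> peak_bound n \<and>
      clock s \<le> 100 * (n + 1) ^ 2 * Suc (\<Sum>x<n. w x))"
proof -
  have B: "1 \<le> peak_bound n" by (simp add: peak_bound_def)
  have T: "inj_on T {..<n}" "\<And>x. x < n \<Longrightarrow> 0 < T x \<and> T x \<le> n"
  proof -
    show "inj_on T {..<n}"
    proof (rule inj_onI)
      fix x y assume xy: "x \<in> {..<n}" "y \<in> {..<n}" "T x = T y"
      then have "n - x = n - y" using permutes_inj[OF \<sigma>] by (auto simp: T_def dest: injD)
      with xy show "x = y" by auto
    qed
    show "0 < T x \<and> T x \<le> n" if "x < n" for x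
      using permutes_in_image[OF \<sigma>, of "n - x"] that by (auto simp: T_def)
  qed
  let ?s0 = "start (perm_input n \<sigma>)"
  let ?A = "(VConst rOne 1 ;; Input rN ;; VAdd rI rN rZero) ;; Loop rI read_body"
  let ?B = "(VConst rW 1 ;; VAdd rC rN rZero)"
  let ?C = "Put aTable rZero rOne ;; VSub rC rW rOne"
  have init: "hoare (peak_bound n)
     (\<lambda>s. base n T s \<and> var s rM = 0 \<and> var s rP = 0 \<and> arr s aWeight = (\<lambda>_. 0)) ?B 2
     (\<lambda>s. round_state n T n s \<and> var s rC = n)"
    using peeling_init[of n T] peak_bounds(1)[of n n] B
    by (intro hoareI) (simp add: round_state_def base_def)
  have peel: "hoare (peak_bound n) (\<lambda>s. round_state n T n s \<and> var s rC = n)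
     (Loop rC peel_round) (n * (47 * n + 7 + 6) + 3) (round_state n T 0)"
    by (rule hoare_Loop[OF hoare_peel_round[OF T] round_state_stable B])
  define s1 where "s1 = exec ((?A ;; ?B) ;; Loop rC peel_round) ?s0"
  have s1: "round_state n T 0 s1" "clock s1 \<le> 13 * n + 6 + 2 + (n * (47 * n + 7 + 6) + 3)"
    "peak s1 \<le> peak_bound n"
  proof -
    have "peak ?s0 \<le> peak_bound n" "clock ?s0 = 0" by (simp_all add: start_def)
    with hoare_Seq[OF hoare_Seq[OF hoare_read[OF \<sigma>, folded T_def] init] peel]
    show "round_state n T 0 s1" "clock s1 \<le> 13 * n + 6 + 2 + (n * (47 * n + 7 + 6) + 3)"
      "peak s1 \<le> peak_bound n"
      unfolding hoare_def s1_def by (metis add_0)+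
  qed
  define w ord where "w = arr s1 aWeight" and "ord = arr s1 aOrd"
  from s1(1) have inv: "peeling n T (var s1 rP) (var s1 rW) w (var s1 rW) 0 (var s1 rP) ord n"
    and lt: "\<And>x. w x < var s1 rW" and b: "base n T s1" "var s1 rM = 0" "n \<le> var s1 rP"
    and W: "var s1 rW \<le> 2 ^ var s1 rP"
    by (auto simp: round_state_def w_def ord_def)
  have "var s1 rP = n" using b(3) peeling.p_le[OF inv] by simp
  from peeling_coding[OF inv T peeling.all_assigned[OF inv this] lt]
  interpret coding n T w ord .
  have W': "var s1 rW = Suc total_weight"
    using peeling.acc_eq[OF inv] by (simp add: total_weight_def)
  with W \<open>var s1 rP = n\<close> have m: "total_weight \<le> 2 ^ n" by simp
  define s2 where "s2 = exec ?C s1"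
  define F where "F = (arr s1 aTable)(0 := 1)"
  have b': "var s1 rZero = 0" "var s1 rOne = 1" using b(1) by (simp_all add: base_def)
  have "table_inv 1 F" by (rule table_init) (simp add: F_def)
  moreover have "arr s2 aWeight = w" "arr s2 aOrd = ord" "arr s2 aTable = F" "base n T s2" "var s2 rM = 0"
    using b(1,2) b' by (simp_all add: s2_def F_def base_def w_def ord_def)
  then have "table_state 0 F s2" by (simp add: table_state_def)
  moreover have "var s2 rC = total_weight" using W' b' by (simp add: s2_def)
  ultimately have s2: "table_state 0 F s2 \<and> table_inv 1 F \<and> var s2 rC = total_weight" by blast
  have s2': "clock s2 \<le> clock s1 + 7" "peak s2 \<le> peak_bound n"
    using b' s1(3) peak_bounds(1)[of 0 n] by (simp_all add: s2_def)
  let ?s = "exec count_program ?s0"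
  have s: "?s = exec (Loop rC table_body ;; Fetch rOut aTable rM) s2"
    by (simp only: count_program_def s1_def s2_def exec.simps(7))
  have fin: "var ?s rOut = card (lin_exts T {..<n})" "peak ?s \<le> peak_bound n"
    "clock ?s \<le> clock s2 + (total_weight * (83 * n + 24) + 9)"
    using hoare_table[OF m, of F] s2 s2'(2) unfolding s hoare_def by blast+
  have "clock ?s \<le> 47 * n\<^sup>2 + 26 * n + 27 + total_weight * (83 * n + 24)"
    using fin(3) s2'(1) s1(2) by (simp add: power2_eq_square algebra_simps)
  also have "\<dots> \<le> 100 * (n + 1)\<^sup>2 + total_weight * (100 * (n + 1)\<^sup>2)"
    by (intro add_mono mult_le_mono2) (simp_all add: power2_eq_square algebra_simps)
  also have "\<dots> = 100 * (n + 1)\<^sup>2 * Suc total_weight" by simp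
  finally have "clock ?s \<le> 100 * (n + 1)\<^sup>2 * Suc total_weight" .
  with fin coding_axioms card_weak_interval[OF \<sigma>] show ?thesis
    by (intro exI[of _ w] exI[of _ ord]) (simp add: Let_def total_weight_def T_def)
qed

section \<open>Permutations with few chains\<close>

definition decreasing_on :: "nat set \<Rightarrow> (nat \<Rightarrow> nat) \<Rightarrow> bool" where
  "decreasing_on A \<sigma> \<longleftrightarrow> (\<forall>p\<in>A. \<forall>q\<in>A. p < q \<longrightarrow> \<sigma> q < \<sigma> p)"

text \<open>Rearranging the entries of \<sigma> on A in all k! ways is injective in both data: if
  two permutations decreasing on A differ by a rearrangement \<open>q\<close> of A, then
  \<open>q\<close> is increasing on A and hence the identity.\<close>

lemma card_decreasing_on:
  assumes "A \<subseteq> {1..n}" "card A = k"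
  shows "card {\<sigma>. \<sigma> permutes {1..n} \<and> decreasing_on A \<sigma>} * fact k \<le> (fact n :: nat)"
proof -
  define D where "D = {\<sigma>. \<sigma> permutes {1..n} \<and> decreasing_on A \<sigma>}"
  define Q where "Q = {\<pi>. \<pi> permutes A}"
  have "finite A" using assms(1) finite_subset by blast
  then have Q: "card Q = fact k" unfolding Q_def using assms(2) by (intro card_permutations)
  have "inj_on (\<lambda>(\<sigma>, \<pi>). \<sigma> \<circ> \<pi>) (D \<times> Q)"
  proof (rule inj_onI, clarify)
    fix \<sigma> \<pi> \<sigma>' \<pi>' assume *: "\<sigma> \<in> D" "\<pi> \<in> Q" "\<sigma>' \<in> D" "\<pi>' \<in> Q" and eq: "\<sigma> \<circ> \<pi> = \<sigma>' \<circ> \<pi>'"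
    then have p: "\<pi> permutes A" "\<pi>' permutes A" by (simp_all add: Q_def)
    define q where "q = \<pi> \<circ> inv \<pi>'"
    have q: "q permutes A" unfolding q_def using p by (intro permutes_compose permutes_inv)
    have "\<pi>' \<circ> inv \<pi>' = id" using permutes_inv_o(1)[OF p(2)] .
    with eq have s': "\<sigma>' = \<sigma> \<circ> q" unfolding q_def by (metis comp_assoc comp_id)
    have "strict_mono_on A q"
    proof (rule strict_mono_onI)
      fix a b assume ab: "a \<in> A" "b \<in> A" "a < b"
      then have qab: "q a \<in> A" "q b \<in> A" using permutes_in_image[OF q] by blast+
      have "\<sigma> (q b) < \<sigma> (q a)" using *(3) ab by (auto simp: D_def decreasing_on_def s')
      then have "q a \<noteq> q b" "\<not> q b < q a"
        using *(1) qab by (auto simp: D_def decreasing_on_def) (metis not_less_iff_gr_or_eq)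
      then show "q a < q b" by simp
    qed
    from strict_mono_permutes_eq[OF q this] have "q x = x" for x
      using permutes_not_in[OF q] by (cases "x \<in> A") blast+
    then have "q = id" by (simp add: fun_eq_iff)
    then have "\<sigma>' = \<sigma>" using s' by simp
    have "\<pi> = q \<circ> \<pi>'" using permutes_inv_o(2)[OF p(2)] unfolding q_def by (metis comp_assoc comp_id)
    with \<open>q = id\<close> \<open>\<sigma>' = \<sigma>\<close> show "\<sigma> = \<sigma>' \<and> \<pi> = \<pi>'" by simp
  qed
  moreover have "(\<lambda>(\<sigma>, \<pi>). \<sigma> \<circ> \<pi>) ` (D \<times> Q) \<subseteq> {\<tau>. \<tau> permutes {1..n}}"
    using assms(1) by (auto simp: D_def Q_def intro: permutes_compose permutes_subset)
  ultimately have "card (D \<times> Q) \<le> card {\<tau>. \<tau> permutes {1..n}}"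
    by (intro card_inj_on_le) (auto intro: finite_permutations)
  then show ?thesis by (simp add: card_cartesian_product Q card_permutations D_def)
qed

definition long_decreasing :: "nat \<Rightarrow> nat \<Rightarrow> (nat \<Rightarrow> nat) set" where
  "long_decreasing n k =
     {\<sigma>. \<sigma> permutes {1..n} \<and> (\<exists>A\<subseteq>{1..n}. card A = k \<and> decreasing_on A \<sigma>)}"

lemma card_long_decreasing: "card (long_decreasing n k) * fact k \<le> (n choose k) * fact n"
proof -
  define \<A> where "\<A> = {A. A \<subseteq> {1..n} \<and> card A = k}"
  define D where "D A = {\<sigma>. \<sigma> permutes {1..n} \<and> decreasing_on A \<sigma>}" for A
  have fin: "finite \<A>" unfolding \<A>_def by simp
  have "long_decreasing n k = (\<Union>A\<in>\<A>. D A)"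
    by (auto simp: long_decreasing_def \<A>_def D_def)
  then have "card (long_decreasing n k) \<le> (\<Sum>A\<in>\<A>. card (D A))"
    using card_UN_le[OF fin] by simp
  then have "card (long_decreasing n k) * fact k \<le> (\<Sum>A\<in>\<A>. card (D A)) * fact k"
    by (rule mult_le_mono1)
  also have "\<dots> = (\<Sum>A\<in>\<A>. card (D A) * fact k)" by (rule sum_distrib_right)
  also have "\<dots> \<le> (\<Sum>A\<in>\<A>. fact n)"
    using card_decreasing_on unfolding \<A>_def D_def by (intro sum_mono) blast
  also have "\<dots> = (n choose k) * fact n"
    using n_subsets[of "{1..n}" k] by (simp add: \<A>_def)
  finally show ?thesis .
qed

text \<open>Reflecting indices to positions turns the increasing selection, one element per chain,
  into a decreasing subsequence.\<close>

lemma (in coding) few_weights: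
  assumes "\<sigma> permutes {1..n}" "\<sigma> \<notin> long_decreasing n k" "T = (\<lambda>x. \<sigma> (n - x))"
  shows "card (w ` {..<n}) < k"
proof (rule ccontr)
  assume "\<not> card (w ` {..<n}) < k"
  with ex_antichain_card obtain C where C: "C \<subseteq> {..<n}" "strict_mono_on C T" "k \<le> card C" by auto
  \<comment> \<open>\<open>long_decreasing\<close> asks for exactly \<open>k\<close> positions, so a
    longer selection is trimmed.\<close>
  then obtain C' where C': "C' \<subseteq> C" "card C' = k" by (metis obtain_subset_with_card_n)
  let ?A = "(\<lambda>x. n - x) ` C'"
  have lt: "x < n" if "x \<in> C'" for x using that C(1) C'(1) by auto
  have "card ?A = k"
  proof (subst card_image)
    show "inj_on ((-) n) C'"
    proof (rule inj_onI)
      fix x y assume "x \<in> C'" "y \<in> C'" "n - x = n - y"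
      with lt[of x] lt[of y] show "x = y" by linarith
    qed
  qed (rule C'(2))
  moreover have "decreasing_on ?A \<sigma>"
    unfolding decreasing_on_def
  proof clarify
    fix x y assume xy: "x \<in> C'" "y \<in> C'" "n - x < n - y"
    then have "y < x" by linarith
    then have "T y < T x" using strict_mono_onD[OF C(2)] C'(1) xy by blast
    then show "\<sigma> (n - y) < \<sigma> (n - x)" by (simp add: assms(3))
  qed
  moreover have "?A \<subseteq> {1..n}" using lt by fastforce
  ultimately show False using assms(1,2) unfolding long_decreasing_def by blast
qed

text \<open>Each logarithm is bounded by the tangent of \<open>ln\<close> at sqrt n, the order of
  magnitude of a typical chain length. The chain lengths add up to n, so the linear terms contribute
  O(sqrt n), and \<open>ln (sqrt n) = ln n / 2\<close> gives 7/4.\<close>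

lemma (in coding) total_le_exp:
  assumes n: "0 < n" and c: "real (card (w ` {..<n})) \<le> 7 / 2 * sqrt n"
  shows "real (Suc (\<Sum>x<n. w x)) \<le> exp (7 / 4 * sqrt n * ln n + 7 / 2 + sqrt n)"
proof -
  define V where "V = w ` {..<n}"
  define m where "m v = card {x. x < n \<and> w x = v}" for v
  define a where "a = sqrt n"
  have a: "0 < a" "1 \<le> a" "a * a = real n" using n by (auto simp: a_def)
  have fin: "finite V" by (simp add: V_def)
  have "card {..<n} = (\<Sum>v\<in>V. card {x\<in>{..<n}. w x = v})"
    unfolding V_def using sum.image_gen[OF finite_lessThan, of "\<lambda>_. 1 :: nat" n w] by simp
  then have sum_m: "(\<Sum>v\<in>V. m v) = n" by (simp add: m_def)
  have ln: "ln (real (Suc (m v))) \<le> ln a + real (Suc (m v)) / a" for v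
  proof -
    have "ln (real (Suc (m v)) / a) \<le> real (Suc (m v)) / a - 1"
      using a by (intro ln_le_minus_one) auto
    then show ?thesis using a by (simp add: ln_div)
  qed
  have "real (Suc (\<Sum>x<n. w x)) = (\<Prod>v\<in>V. real (Suc (m v)))"
    unfolding code_Suc_prod V_def m_def by simp
  also have "\<dots> = exp (\<Sum>v\<in>V. ln (real (Suc (m v))))"
    by (subst exp_sum[OF fin]) simp
  also have "\<dots> \<le> exp (\<Sum>v\<in>V. ln a + real (Suc (m v)) / a)"
    using ln by (intro exp_mono sum_mono)
  also have "(\<Sum>v\<in>V. ln a + real (Suc (m v)) / a) =
      real (card V) * ln a + (\<Sum>v\<in>V. real (Suc (m v))) / a"
    by (simp only: sum.distrib sum_constant sum_divide_distrib)
  also have "(\<Sum>v\<in>V. real (Suc (m v))) = real (card V) + real n"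
    using sum_m by (simp add: sum.distrib flip: of_nat_sum)
  also have "real (card V) * ln a + (real (card V) + real n) / a \<le>
      7 / 2 * a * ln a + (7 / 2 * a + real n) / a"
    using c a unfolding V_def a_def by (intro add_mono mult_right_mono divide_right_mono) auto
  also have "\<dots> = 7 / 4 * sqrt n * ln n + 7 / 2 + sqrt n"
  proof -
    have "ln a = ln n / 2" using n by (simp add: a_def ln_sqrt)
    moreover have "(7 / 2 * a + real n) / a = 7 / 2 + a" using a by (simp add: field_simps)
    ultimately show ?thesis by (simp add: a_def)
  qed
  finally show ?thesis by simp
qed

text \<open>The factorial dominates: n! is at most n^n, which is at most 2^(n*n). Thus the cost of
  an instruction is polynomial in n.\<close>

lemma len_peak_bound: "len (peak_bound n) \<le> n * n + n + 8"
proof -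
  have "n ^ n \<le> (2 ^ n) ^ n" using less_exp[of n] by (intro power_mono) auto
  then have "fact n \<le> (2 :: nat) ^ (n * n)"
    using fact_le_power[of n, where 'a = nat] by (simp add: power_mult)
  also have "\<dots> \<le> 2 ^ (n * n + n + 6)" by (intro power_increasing) auto
  finally have 1: "fact n \<le> (2 :: nat) ^ (n * n + n + 6)" .
  have "16 * 2 ^ n = (2 :: nat) ^ (n + 4)" by (simp add: power_add)
  also have "\<dots> \<le> 2 ^ (n * n + n + 6)" by (intro power_increasing) auto
  finally have 2: "16 * 2 ^ n \<le> (2 :: nat) ^ (n * n + n + 6)" .
  have "40 < (2 :: nat) ^ 6" by simp
  also have "\<dots> \<le> 2 ^ (n * n + n + 6)" by (intro power_increasing) auto
  finally have 3: "40 < (2 :: nat) ^ (n * n + n + 6)" .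
  have "(2 :: nat) ^ (n * n + n + 8) = 4 * 2 ^ (n * n + n + 6)" by (simp add: power_add)
  with 1 2 3 have "peak_bound n < 2 ^ (n * n + n + 8)" unfolding peak_bound_def by linarith
  then have "floorlog 2 (peak_bound n) \<le> n * n + n + 8" by (intro floorlog_leI) auto
  then show ?thesis by (simp add: len_def)
qed

text \<open>The proportion is at most n^k / (k!)^2. With k! at least (k/3)^k and k^2 at least 49 n /
  4 it is at most (9 * 4 / 49)^k = (36/49)^k. Using 3 in place of e is affordable since 3 <
  7/2.\<close>

lemma long_decreasing_rare:
  assumes n: "0 < n"
  shows "real (card (long_decreasing n (nat \<lceil>7 / 2 * sqrt n\<rceil>))) \<le> fact n * exp (- (13 / 14 * sqrt n))"
proof -
  define k where "k = nat \<lceil>7 / 2 * sqrt n\<rceil>"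
  have k: "7 / 2 * sqrt n \<le> real k" unfolding k_def by linarith
  moreover have "0 < sqrt n" using n by simp
  ultimately have k0: "0 < real k" by linarith
  have "(7 / 2 * sqrt n)\<^sup>2 \<le> (real k)\<^sup>2" using k by (intro power_mono) auto
  then have kn: "49 / 4 * real n \<le> (real k)\<^sup>2" by (simp add: power_mult_distrib power2_eq_square)
  \<comment> \<open>A single term of the exponential series at k.\<close>
  have "real k ^ k / fact k \<le> exp (real k)"
    using sum_le_suminf[OF summable_exp_generic[of "real k"], of "{k}"]
    by (simp add: exp_def field_simps)
  also have "\<dots> = exp 1 ^ k" by (simp add: exp_of_nat_mult[symmetric])
  also have "\<dots> \<le> 3 ^ k" using exp_le by (intro power_mono) auto
  finally have f: "real k ^ k \<le> 3 ^ k * fact k" by (simp add: field_simps)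
  have "real ((n choose k) * fact k) \<le> real (n ^ k)" using binomial_fact_pow of_nat_mono by blast
  then have c: "real (n choose k) * fact k \<le> real n ^ k" by simp
  have "real (card (long_decreasing n k)) * fact k \<le> real (n choose k) * fact n"
    using card_long_decreasing[of n k] by (metis of_nat_fact of_nat_le_iff of_nat_mult)
  then have "real (card (long_decreasing n k)) * fact k * fact k \<le> real (n choose k) * fact n * fact k"
    by (intro mult_right_mono) auto
  also have "\<dots> \<le> real n ^ k * fact n" using c by (simp add: mult_ac)
  finally have 1: "real (card (long_decreasing n k)) * (fact k)\<^sup>2 \<le> real n ^ k * fact n"
    by (simp add: power2_eq_square mult_ac)
  have "(real k ^ k)\<^sup>2 \<le> (3 ^ k * fact k)\<^sup>2" using f by (intro power_mono) auto
  then have "((real k)\<^sup>2) ^ k \<le> 9 ^ k * (fact k)\<^sup>2"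
    by (simp add: power_mult_distrib power_mult[symmetric] mult.commute[of k 2])
       (simp add: power_mult)
  moreover have "(49 / 4 * real n) ^ k \<le> ((real k)\<^sup>2) ^ k" using kn by (intro power_mono) auto
  ultimately have "(49 / 4 * real n) ^ k \<le> 9 ^ k * (fact k)\<^sup>2" by linarith
  then have "real (card (long_decreasing n k)) * (49 / 4 * real n) ^ k \<le>
      real (card (long_decreasing n k)) * (9 ^ k * (fact k)\<^sup>2)" by (intro mult_left_mono) auto
  also have "\<dots> = 9 ^ k * (real (card (long_decreasing n k)) * (fact k)\<^sup>2)" by simp
  also have "\<dots> \<le> 9 ^ k * (real n ^ k * fact n)" using 1 by (intro mult_left_mono) auto
  finally have "real (card (long_decreasing n k)) * (49 / 4) ^ k * real n ^ k \<le>
      9 ^ k * fact n * real n ^ k"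
    by (simp only: power_mult_distrib mult_ac)
  then have "real (card (long_decreasing n k)) * (49 / 4) ^ k \<le> 9 ^ k * fact n"
    using n by (subst (asm) mult_le_cancel_right) auto
  then have "real (card (long_decreasing n k)) \<le> fact n * (36 / 49) ^ k"
    by (simp add: field_simps power_divide) (simp add: power_mult_distrib[symmetric])
  \<comment> \<open>Here 36/49 = 1 - 13/49, and 13/49 * 7/2 = 13/14 gives the final
    exponent.\<close>
  also have "(36 / 49 :: real) ^ k \<le> exp (- 13 / 49) ^ k"
    using exp_ge_add_one_self[of "- 13 / 49"] by (intro power_mono) auto
  also have "\<dots> = exp (- (13 / 49 * real k))" by (simp add: exp_of_nat_mult[symmetric])
  also have "\<dots> \<le> exp (- (13 / 14 * sqrt n))" using k by simp
  finally show ?thesis by (simp add: k_def)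
qed

text \<open>The exponent 1/4 is chosen with room to spare: any exponent below 1/2 is
  dominated.\<close>

lemma eventually_rare:
  "\<forall>\<^sub>F n in sequentially. exp (- (13 / 14 * sqrt (real n))) \<le> exp (- (real n powr (1 / 4)))"
  by real_asymp

text \<open>The gap between 7/4 and 2 leaves a factor exp (sqrt n * ln n / 4), which absorbs the
  polynomial and exp (O(sqrt n)).\<close>

lemma eventually_time:
  "\<forall>\<^sub>F n in sequentially.
     2 * (real n * real n + real n + 8) *
       (100 * (real n + 1) ^ 2 * exp (7 / 4 * sqrt (real n) * ln (real n) + 7 / 2 + sqrt (real n)))
     \<le> exp (2 * sqrt (real n) * ln (real n))"
  by real_asymp

section \<open>Machine time of the program and the final count\<close>

lemma count_program_time:
  assumes "\<sigma> permutes {1..n}"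
  obtains w ord t where "coding n (\<lambda>x. \<sigma> (n - x)) w ord"
    "ram_computes (compile 0 count_program) (perm_input n \<sigma>) (card (weak_interval n \<sigma>)) t"
    "t \<le> 2 * (n * n + n + 8) * (100 * (n + 1)\<^sup>2 * Suc (\<Sum>x<n. w x))"
proof -
  let ?s = "exec count_program (start (perm_input n \<sigma>))"
  from count_program_correct[OF assms] obtain w ord where
    coding: "coding n (\<lambda>x. \<sigma> (n - x)) w ord" and out: "var ?s 0 = card (weak_interval n \<sigma>)"
    and bounds: "peak ?s \<le> peak_bound n" "clock ?s \<le> 100 * (n + 1)\<^sup>2 * Suc (\<Sum>x<n. w x)"
    unfolding Let_def by blast
  from ram_computes_compile[OF wf_count_program bounds] obtain t where
    t: "t \<le> 2 * len (peak_bound n) * (100 * (n + 1)\<^sup>2 * Suc (\<Sum>x<n. w x))"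
      "ram_computes (compile 0 count_program) (perm_input n \<sigma>) (var ?s 0) t"
    by blast
  have "2 * len (peak_bound n) \<le> 2 * (n * n + n + 8)"
    using len_peak_bound[of n] by simp
  from order_trans[OF t(1) mult_le_mono1[OF this]] coding t(2) show ?thesis
    unfolding out by (rule that[rotated 2])
qed

lemma count_program_fast:
  assumes "\<sigma> permutes {1..n}" "0 < n" "\<sigma> \<notin> long_decreasing n (nat \<lceil>7 / 2 * sqrt n\<rceil>)"
  shows "\<exists>t. ram_computes (compile 0 count_program) (perm_input n \<sigma>) (card (weak_interval n \<sigma>)) t \<and>
    real t \<le> 2 * (real n * real n + real n + 8) *
       (100 * (real n + 1) ^ 2 * exp (7 / 4 * sqrt (real n) * ln (real n) + 7 / 2 + sqrt (real n)))"
proof -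
  from count_program_time[OF assms(1)] obtain w ord t where
    "coding n (\<lambda>x. \<sigma> (n - x)) w ord"
    and t: "ram_computes (compile 0 count_program) (perm_input n \<sigma>) (card (weak_interval n \<sigma>)) t"
      "t \<le> 2 * (n * n + n + 8) * (100 * (n + 1)\<^sup>2 * Suc (\<Sum>x<n. w x))" .
  then interpret coding n "\<lambda>x. \<sigma> (n - x)" w ord by simp
  have "card (w ` {..<n}) < nat \<lceil>7 / 2 * sqrt n\<rceil>"
    by (rule few_weights[OF assms(1,3) refl])
  \<comment> \<open>An integer below the ceiling of a real number is below that number
    itself.\<close>
  then have "int (card (w ` {..<n})) < \<lceil>7 / 2 * sqrt n\<rceil>" by simp
  then have "real (card (w ` {..<n})) \<le> 7 / 2 * sqrt n" by (simp add: less_ceiling_iff)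
  note M = total_le_exp[OF assms(2) this]
  have "real t \<le> real (2 * (n * n + n + 8) * (100 * (n + 1)\<^sup>2 * Suc (\<Sum>x<n. w x)))"
    using t(2) by (rule of_nat_mono)
  also have "\<dots> = 2 * (real n * real n + real n + 8) *
      (100 * (real n + 1)\<^sup>2 * real (Suc (\<Sum>x<n. w x)))"
    by (simp add: algebra_simps)
  also have "\<dots> \<le> 2 * (real n * real n + real n + 8) *
      (100 * (real n + 1)\<^sup>2 * exp (7 / 4 * sqrt n * ln n + 7 / 2 + sqrt n))"
    using M by (intro mult_left_mono) auto
  finally show ?thesis using t(1) by blast
qed

theorem theorem17:
  "\<exists>\<beta>>0. \<exists>P :: instr list. \<exists>\<epsilon> :: nat \<Rightarrow> real.
     (\<forall>n \<sigma>. \<sigma> permutes {1..n} \<longrightarrow>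
        (\<exists>t. ram_computes P (perm_input n \<sigma>) (card (weak_interval n \<sigma>)) t)) \<and>
     \<epsilon> \<longlonglongrightarrow> 0 \<and>
     (\<forall>\<^sub>F n in sequentially.
        fact n * (1 - exp (- (real n powr \<beta>)))
        \<le> real (card {\<sigma>. \<sigma> permutes {1..n} \<and>
             (\<exists>t. ram_computes P (perm_input n \<sigma>) (card (weak_interval n \<sigma>)) t \<and>
                  real t \<le> exp ((2 + \<epsilon> n) * sqrt (real n) * ln (real n)))}))"
proof -
  let ?P = "compile 0 count_program"
  \<comment> \<open>The summand \<open>0\<close> is kept so that the set agrees literally with the
    goal once the error term is instantiated.\<close>
  let ?fast = "\<lambda>n. {\<sigma>. \<sigma> permutes {1..n} \<and>
    (\<exists>t. ram_computes ?P (perm_input n \<sigma>) (card (weak_interval n \<sigma>)) t \<and>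
      real t \<le> exp ((2 + 0) * sqrt (real n) * ln (real n)))}"
  have most: "\<forall>\<^sub>F n in sequentially. fact n * (1 - exp (- (real n powr (1 / 4)))) \<le> real (card (?fast n))"
    using eventually_rare eventually_time eventually_gt_at_top[of 0]
  proof eventually_elim
    case (elim n)
    let ?S = "{\<sigma>. \<sigma> permutes {1..n}}"
    let ?bad = "long_decreasing n (nat \<lceil>7 / 2 * sqrt n\<rceil>)"
    have fin: "finite ?S" by (rule finite_permutations) simp
    have "?S - ?bad \<subseteq> ?fast n"
    proof
      fix \<sigma> assume "\<sigma> \<in> ?S - ?bad"
      then have \<sigma>: "\<sigma> permutes {1..n}" "\<sigma> \<notin> ?bad" by auto
      from count_program_fast[OF \<sigma>(1) elim(3) \<sigma>(2)] elim(2) \<sigma>(1) show "\<sigma> \<in> ?fast n"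
        by (auto intro: order_trans)
    qed
    moreover have "finite (?fast n)" by (rule finite_subset[OF _ fin]) auto
    ultimately have "card (?S - ?bad) \<le> card (?fast n)" by (rule card_mono[rotated])
    moreover have "?bad \<subseteq> ?S" by (auto simp: long_decreasing_def)
    then have "card (?S - ?bad) = card ?S - card ?bad"
      using finite_subset fin by (intro card_Diff_subset)
    ultimately have "card ?S \<le> card (?fast n) + card ?bad" by linarith
    then have "real (card ?S) \<le> real (card (?fast n)) + real (card ?bad)" by linarith
    moreover have "real (card ?S) = fact n" using card_permutations[of "{1..n}" n] by simp
    moreover have "real (card ?bad) \<le> fact n * exp (- (real n powr (1 / 4)))"
      by (rule order_trans[OF long_decreasing_rare[OF elim(3)] mult_left_mono[OF elim(1)]]) simp
    ultimately show ?case by (simp only: right_diff_distrib mult_1_right)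
  qed
  have all: "\<exists>t. ram_computes ?P (perm_input n \<sigma>) (card (weak_interval n \<sigma>)) t"
    if "\<sigma> permutes {1..n}" for n \<sigma>
    using count_program_time[OF that] by blast
  show ?thesis
  proof (intro exI[of _ "1 / 4"] exI[of _ ?P] exI[of _ "\<lambda>_. 0 :: real"] conjI allI impI)
    show "(0 :: real) < 1 / 4" by simp
    show "(\<lambda>_. 0 :: real) \<longlonglongrightarrow> 0" by (rule tendsto_const)
  qed (fact all most)+
qed

end
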